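(* Let $X,U$ be Banach spaces, $(S_t)_{t\ge 0}$ a $C_0$-semigroup on $X$, $B\in\mathcal{L}(U,X)$, $T>0$, $r\in[1,\infty]$, and let $L_T\in\mathcal{L}(L_r((0,T);U),X)$ be the controllability map $L_Tu=\int_0^T S_{T-\tau}Bu(\tau)\,\mathrm{d}\tau$. Let further $C\ge 0$ and $\alpha\ge 0$. Then the following statements are equivalent: (a) For every $x\in X\setminus\{0\}$ and every $\varepsilon>0$ there exists $u\in L_r((0,T);U)$ with $$\|u\|_{L_r((0,T);U)}\le C\|x\|_X\quad\text{and}\quad \|S_Tx+L_Tu\|_X<(\alpha+\varepsilon)\|x\|_X.$$ (b) For all $x'\in X'$ we have $$\|S_T'x'\|_{X'}\le\begin{cases} C\left(\int_0^T\|B'S_t'x'\|_{U'}^{r'}\,\mathrm{d}t\right)^{1/r'}+\alpha\|x'\|_{X'} & \text{if } r'\in[1,\infty),\\[1ex] C\sup_{t\in[0,T]}\|B'S_t'x'\|_{U'}+\alpha\|x'\|_{X'} & \text{if } r'=\infty,\end{cases}$$ where $r'\in[1,\infty]$ is such that $1/r+1/r'=1$ (with $1/\infty=0$).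
   Context: $\mathcal{L}(U,X)$ denotes the bounded linear operators from $U$ to $X$. $X'$, $U'$ denote the topological dual spaces, and $S_t'\in\mathcal{L}(X')$, $B'\in\mathcal{L}(X',U')$ denote the dual (adjoint) operators. $L_r((0,T);U)$ is the Bochner–Lebesgue space. *)

theory Defs
  imports "HOL-Probability.Essential_Supremum"
begin

section \<open>Banach spaces over the real or complex numbers\<close>

text \<open>
  An instance is, via the embedding, a subfield of the complex numbers containing the reals, i.e. isometrically
  isomorphic to the reals or to the complex numbers.
\<close>

class real_or_complex = real_normed_field +
  assumes complex_embedding:
    "\<exists>h :: 'a \<Rightarrow> complex. h 1 = 1 \<and> (\<forall>a b. h (a + b) = h a + h b) \<and> (\<forall>a b. h (a * b) = h a * h b) \<and>
       (\<forall>r a. h (r *\<^sub>R a) = r *\<^sub>R h a) \<and> (\<forall>a. norm (h a) = norm a)"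

instance real :: real_or_complex
  by standard (rule exI[of _ complex_of_real], simp add: scaleR_conv_of_real)

instance complex :: real_or_complex
  by standard (rule exI[of _ "\<lambda>z. z"], simp)

text \<open>
  The type class of the carrier type provides the real structure, the norm and (for \<open>banach\<close>)
  completeness; \<open>scl\<close> provides the multiplication with the scalars of the field \<open>'k\<close>.
\<close>

locale normed_space_over = vector_space scl
  for scl :: "'k::real_or_complex \<Rightarrow> 'v::real_normed_vector \<Rightarrow> 'v" +
  assumes scale_of_real: "scl (of_real r) x = r *\<^sub>R x"
    and norm_scale: "norm (scl c x) = norm c * norm x"

lemma normed_space_over_real: "normed_space_over ((*\<^sub>R) :: real \<Rightarrow> 'v::real_normed_vector \<Rightarrow> 'v)"
  by standard (simp_all add: algebra_simps)

lemma normed_space_over_self: "normed_space_over ((*) :: 'k::real_or_complex \<Rightarrow> 'k \<Rightarrow> 'k)"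
  by standard (simp_all add: algebra_simps scaleR_conv_of_real norm_mult)

definition bounded_ops ::
  "('k::real_or_complex \<Rightarrow> 'a::real_normed_vector \<Rightarrow> 'a) \<Rightarrow> ('k \<Rightarrow> 'b::real_normed_vector \<Rightarrow> 'b) \<Rightarrow>
    ('a \<Rightarrow>\<^sub>L 'b) set"
  where "bounded_ops scaleA scaleB = {A. \<forall>c x. blinfun_apply A (scaleA c x) = scaleB c (blinfun_apply A x)}"

definition dual_space ::
  "('k::real_or_complex \<Rightarrow> 'a::real_normed_vector \<Rightarrow> 'a) \<Rightarrow> ('a \<Rightarrow>\<^sub>L 'k) set"
  where "dual_space scl = bounded_ops scl (*)"

lemma bounded_ops_real: "bounded_ops (*\<^sub>R) (*\<^sub>R) = UNIV"
  by (auto simp: bounded_ops_def blinfun.scaleR_right)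

lemma dual_space_real: "dual_space (*\<^sub>R) = UNIV"
  by (auto simp: dual_space_def bounded_ops_def blinfun.scaleR_right)

definition dual_op ::
  "('a::real_normed_vector \<Rightarrow>\<^sub>L 'b::real_normed_vector) \<Rightarrow> ('b \<Rightarrow>\<^sub>L 'k::real_or_complex) \<Rightarrow> ('a \<Rightarrow>\<^sub>L 'k)"
  where "dual_op A x' = x' o\<^sub>L A"

section \<open>Semigroups\<close>

text \<open>Only the values of \<open>S\<close> at nonnegative times are relevant.\<close>

definition C0_semigroup ::
  "('k::real_or_complex \<Rightarrow> 'x::real_normed_vector \<Rightarrow> 'x) \<Rightarrow> (real \<Rightarrow> ('x \<Rightarrow>\<^sub>L 'x)) \<Rightarrow> bool"
  where "C0_semigroup scl S \<longleftrightarrow>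
    (\<forall>t\<ge>0. S t \<in> bounded_ops scl scl) \<and>
    S 0 = id_blinfun \<and>
    (\<forall>s\<ge>0. \<forall>t\<ge>0. S (s + t) = S s o\<^sub>L S t) \<and>
    (\<forall>x. ((\<lambda>t. blinfun_apply (S t) x) \<longlongrightarrow> x) (at_right 0))"

section \<open>Bochner integral and Bochner-Lebesgue spaces\<close>

text \<open>
  The library's \<open>has_bochner_integral\<close> requires a second-countable (i.e. separable) codomain.  The
  following is the same construction for arbitrary normed spaces, with strong measurability in place
  of Borel measurability.
\<close>

definition strongly_measurable :: "'a measure \<Rightarrow> ('a \<Rightarrow> 'b::real_normed_vector) \<Rightarrow> bool"
  where "strongly_measurable M f \<longleftrightarrow>
    (\<exists>s :: nat \<Rightarrow> 'a \<Rightarrow> 'b. (\<forall>i. simple_function M (s i)) \<and> (AE t in M. (\<lambda>i. s i t) \<longlonglongrightarrow> f t))"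

definition has_strong_bochner_integral ::
  "'a measure \<Rightarrow> ('a \<Rightarrow> 'b::real_normed_vector) \<Rightarrow> 'b \<Rightarrow> bool"
  where "has_strong_bochner_integral M f x \<longleftrightarrow>
    strongly_measurable M f \<and>
    (\<exists>s :: nat \<Rightarrow> 'a \<Rightarrow> 'b. (\<forall>i. Bochner_Integration.simple_bochner_integrable M (s i)) \<and>
      (\<lambda>i. \<integral>\<^sup>+ t. ennreal (norm (f t - s i t)) \<partial>M) \<longlonglongrightarrow> 0 \<and>
      (\<lambda>i. Bochner_Integration.simple_bochner_integral M (s i)) \<longlonglongrightarrow> x)"

definition strong_bochner_integral :: "'a measure \<Rightarrow> ('a \<Rightarrow> 'b::real_normed_vector) \<Rightarrow> 'b"
  where "strong_bochner_integral M f =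
    (if \<exists>x. has_strong_bochner_integral M f x then THE x. has_strong_bochner_integral M f x else 0)"

text \<open>
  \<open>Lp_space p M\<close> consists of representatives: functions are not identified when they agree almost
  everywhere, so \<open>Lp_norm\<close> is a seminorm on it.
\<close>

definition Lp_space :: "ennreal \<Rightarrow> 'a measure \<Rightarrow> ('a \<Rightarrow> 'b::real_normed_vector) set"
  where "Lp_space p M = {f. strongly_measurable M f \<and>
    (if p = \<infinity> then esssup M (\<lambda>t. ennreal (norm (f t))) < \<infinity>
     else integrable M (\<lambda>t. norm (f t) powr enn2real p))}"

definition Lp_norm :: "ennreal \<Rightarrow> 'a measure \<Rightarrow> ('a \<Rightarrow> 'b::real_normed_vector) \<Rightarrow> real"
  where "Lp_norm p M f =
    (if p = \<infinity> then enn2real (esssup M (\<lambda>t. ennreal (norm (f t))))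
     else (\<integral>t. norm (f t) powr enn2real p \<partial>M) powr (1 / enn2real p))"

definition controllability_map ::
  "(real \<Rightarrow> ('x::real_normed_vector \<Rightarrow>\<^sub>L 'x)) \<Rightarrow> ('u::real_normed_vector \<Rightarrow>\<^sub>L 'x) \<Rightarrow> real \<Rightarrow> (real \<Rightarrow> 'u) \<Rightarrow> 'x"
  where "controllability_map S B T u =
    strong_bochner_integral (lebesgue_on {0<..<T})
      (\<lambda>\<tau>. blinfun_apply (S (T - \<tau>)) (blinfun_apply B (u \<tau>)))"

end

theory Submission
  imports Defs
begin

text \<open>
  Fix \<open>x\<close> and put \<open>R = C \<parallel>x\<parallel>\<close>.  Statement (a) says that the convex set
  \<open>{S_T x + L_T u | \<parallel>u\<parallel> \<le> R}\<close> meets every ball around the origin of radius larger than \<open>\<alpha> \<parallel>x\<parallel>\<close>,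
  and statement (b) is what duality makes of this.  The link is the formula
  \<open>x'(L_T u) = \<integral> x'(S_{T-\<tau>} B u(\<tau>)) d\<tau>\<close> together with the fact that the functional \<open>x' \<circ> L_T\<close> on \<open>L_r\<close> has
  norm exactly \<open>N(x')\<close>, the \<open>L_{r'}\<close> norm of \<open>\<tau> \<mapsto> \<parallel>B' S'_{T-\<tau>} x'\<parallel>\<close>.  The expression in (b) is that norm
  after the reflection \<open>t = T - \<tau>\<close>.

  From (a) to (b), write \<open>x'(S_T x) = x'(S_T x + L_T u) - x'(L_T u)\<close>: a control \<open>u\<close> from (a) makes
  the first term in absolute value at most \<open>\<parallel>x'\<parallel> (\<alpha> + \<epsilon>) \<parallel>x\<parallel>\<close>, and Hoelder's inequality
  bounds the second by \<open>R N(x')\<close> (\<open>functional_control_bound\<close>).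

  From (b) to (a), suppose that every admissible \<open>u\<close> has \<open>\<parallel>S_T x + L_T u\<parallel> \<ge> (\<alpha> + \<epsilon>) \<parallel>x\<parallel>\<close>.  The
  Hahn-Banach theorem separates the convex set from the ball
  (\<open>separate_convex_from_ball\<close>): some \<open>x'\<close> with \<open>\<parallel>x'\<parallel> \<le> 1\<close> has
  \<open>Re x'(S_T x + L_T u) \<ge> (\<alpha> + \<epsilon>) \<parallel>x\<parallel>\<close> for all these \<open>u\<close>.  Choosing \<open>u\<close> such that \<open>Re x'(L_T u)\<close> is
  nearly \<open>- R N(x')\<close> gives \<open>\<parallel>S_T' x'\<parallel> \<parallel>x\<parallel> \<ge> (\<alpha> + \<epsilon>) \<parallel>x\<parallel> + R N(x')\<close>, up to an arbitrarily small error, and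
  this contradicts (b).

  Since \<open>U\<close> may be neither separable nor reflexive, such a \<open>u\<close> needs a measurable choice of near-maximisers \<open>v\<close> of
  \<open>Re x'(S_{T-\<tau>} B v)\<close> over the unit ball.  These functions of \<open>\<tau>\<close> are continuous, so by the
  Lindeloef property countably many \<open>v\<close> already yield the supremum \<open>\<parallel>B' S'_{T-\<tau>} x'\<parallel>\<close> at every \<open>\<tau>\<close>
  (\<open>countable_sup_subfamily\<close>), and the best among the first \<open>n\<close> of them is a simple function of \<open>\<tau>\<close>
  (\<open>near_optimal_simple_functions\<close>).  Weighted as in the equality case of Hoelder's inequality, these functions
  give the control, by dominated convergence as \<open>n\<close> grows; for \<open>r = 1\<close> a constant control on a short interval does
  (\<open>near_optimal_control\<close>).
\<close>

section \<open>Separation by a functional and uniform boundedness\<close>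

definition sublinear :: "('a::real_vector \<Rightarrow> real) \<Rightarrow> bool"
  where "sublinear p \<longleftrightarrow> (\<forall>x y. p (x + y) \<le> p x + p y) \<and> (\<forall>c\<ge>0. \<forall>x. p (c *\<^sub>R x) = c * p x)"

lemma sublinearD:
  assumes "sublinear p"
  shows "p (x + y) \<le> p x + p y" and "c \<ge> 0 \<Longrightarrow> p (c *\<^sub>R x) = c * p x" and "p 0 = 0" and "- p (- x) \<le> p x"
proof -
  show add: "p (x + y) \<le> p x + p y" for x y
    using assms by (simp add: sublinear_def)
  show scale: "c \<ge> 0 \<Longrightarrow> p (c *\<^sub>R x) = c * p x" for c x
    using assms by (simp add: sublinear_def)
  show zero: "p 0 = 0"
    using scale[of 0 0] by simp
  show "- p (- x) \<le> p x"
    using add[of x "- x"] zero by simp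
qed

text \<open>
  Only one half of homogeneity has to be checked: applied to the factor \<open>1 / c\<close> it gives the other half.
\<close>

lemma sublinearI_le:
  assumes add: "\<And>x y. p (x + y) \<le> p x + p y"
    and scale: "\<And>c x. c > 0 \<Longrightarrow> p (c *\<^sub>R x) \<le> c * p x"
    and zero: "p 0 = 0"
  shows "sublinear p"
  unfolding sublinear_def
proof (intro conjI allI impI)
  fix c :: real and x assume "c \<ge> 0"
  show "p (c *\<^sub>R x) = c * p x"
  proof (cases "c = 0")
    case False
    with \<open>c \<ge> 0\<close> have "c > 0" by simp
    then have "p x \<le> inverse c * p (c *\<^sub>R x)"
      using scale[of "inverse c" "c *\<^sub>R x"] by simp
    then have "c * p x \<le> p (c *\<^sub>R x)"
      using \<open>c > 0\<close> by (simp add: field_simps)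
    with scale[OF \<open>c > 0\<close>, of x] show ?thesis by simp
  qed (simp add: zero)
qed (rule add)

text \<open>
  This provides the lower bounds of chains for Zorn's lemma.  The infimum is finite because
  \<open>q x \<ge> - q (- x) \<ge> - p (- x)\<close>, and subadditivity survives because any two members of the chain lie above
  one of its members.
\<close>

lemma sublinear_INF_chain:
  assumes "Q \<noteq> {}"
    and sub: "\<And>q. q \<in> Q \<Longrightarrow> sublinear q"
    and le: "\<And>q x. q \<in> Q \<Longrightarrow> q x \<le> p x"
    and chain: "\<And>q1 q2. q1 \<in> Q \<Longrightarrow> q2 \<in> Q \<Longrightarrow> q1 \<le> q2 \<or> q2 \<le> q1"
  shows "sublinear (\<lambda>x. INF q\<in>Q. q x)" and "q \<in> Q \<Longrightarrow> (INF q\<in>Q. q x) \<le> q x"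
proof -
  have bdd: "bdd_below ((\<lambda>q. q x) ` Q)" for x
  proof (rule bdd_belowI2)
    fix q assume "q \<in> Q"
    then show "- p (- x) \<le> q x"
      using sublinearD(4)[OF sub, of q x] le[of q "- x"] by simp
  qed
  show lower: "(INF q\<in>Q. q x) \<le> q x" if "q \<in> Q" for q x
    using bdd that by (rule cINF_lower)
  show "sublinear (\<lambda>x. INF q\<in>Q. q x)"
  proof (rule sublinearI_le)
    fix x y
    have *: "(INF q\<in>Q. q (x + y)) \<le> q1 x + q2 y" if q12: "q1 \<in> Q" "q2 \<in> Q" for q1 q2
    proof -
      obtain q where "q \<in> Q" "q \<le> q1" "q \<le> q2"
        using chain[OF q12] q12 by blast
      then show ?thesis
        using lower[of q "x + y"] sublinearD(1)[OF sub, of q x y] le_funD[of q q1 x] le_funD[of q q2 y]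
        by linarith
    qed
    have "(INF q\<in>Q. q (x + y)) - q1 x \<le> (INF q\<in>Q. q y)" if "q1 \<in> Q" for q1
      using *[OF that] by (intro cINF_greatest[OF \<open>Q \<noteq> {}\<close>]) (simp add: algebra_simps)
    then have "(INF q\<in>Q. q (x + y)) - (INF q\<in>Q. q y) \<le> (INF q\<in>Q. q x)"
      by (intro cINF_greatest[OF \<open>Q \<noteq> {}\<close>]) (simp add: algebra_simps)
    then show "(INF q\<in>Q. q (x + y)) \<le> (INF q\<in>Q. q x) + (INF q\<in>Q. q y)"
      by simp
  next
    fix c :: real and x assume "c > 0"
    have "(INF q\<in>Q. q (c *\<^sub>R x)) / c \<le> (INF q\<in>Q. q x)"
    proof (rule cINF_greatest[OF \<open>Q \<noteq> {}\<close>])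
      fix q assume "q \<in> Q"
      then show "(INF q\<in>Q. q (c *\<^sub>R x)) / c \<le> q x"
        using lower[of q "c *\<^sub>R x"] sublinearD(2)[OF sub, of q c x] \<open>c > 0\<close>
        by (simp add: divide_le_eq mult.commute)
    qed
    then show "(INF q\<in>Q. q (c *\<^sub>R x)) \<le> c * (INF q\<in>Q. q x)"
      using \<open>c > 0\<close> by (simp add: divide_le_eq mult.commute)
  next
    show "(INF q\<in>Q. q 0) = 0"
    proof -
      have "(\<lambda>q. q 0) ` Q = (\<lambda>_. 0) ` Q"
        by (rule image_cong) (simp_all add: sublinearD(3) sub)
      with \<open>Q \<noteq> {}\<close> show ?thesis by simp
    qed
  qed
qed

text \<open>
  The infimum lowers \<open>q\<close> and preserves its value at \<open>a\<close>.  With \<open>t = 1\<close> and \<open>y = - a\<close> the bound reads \<open>q' (- a) \<le> - q a\<close>, so a minimal sublinear functional must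
  be odd.
\<close>

lemma sublinear_perturbation:
  fixes q :: "'a::real_vector \<Rightarrow> real" and a :: 'a
  assumes q: "sublinear q"
  defines "q' \<equiv> \<lambda>y. INF t\<in>{0..}. q (y + t *\<^sub>R a) - t * q a"
  shows "sublinear q'" and "t \<ge> 0 \<Longrightarrow> q' y \<le> q (y + t *\<^sub>R a) - t * q a"
proof -
  note add = sublinearD(1)[OF q] and scale = sublinearD(2)[OF q]
  have bdd: "bdd_below ((\<lambda>t. q (y + t *\<^sub>R a) - t * q a) ` {0..})" for y
  proof (rule bdd_belowI2)
    fix t :: real assume "t \<in> {0..}"
    then show "- q (- y) \<le> q (y + t *\<^sub>R a) - t * q a"
      using add[of "y + t *\<^sub>R a" "- y"] scale[of t a] by simp
  qed
  show lower: "q' y \<le> q (y + t *\<^sub>R a) - t * q a" if "t \<ge> 0" for t y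
    unfolding q'_def using bdd by (rule cINF_lower) (use that in simp)
  have greatest: "b \<le> q' y" if "\<And>t. t \<ge> 0 \<Longrightarrow> b \<le> q (y + t *\<^sub>R a) - t * q a" for b y
    unfolding q'_def using that by (intro cINF_greatest) auto
  show "sublinear q'"
  proof (rule sublinearI_le)
    fix x y
    have *: "q' (x + y) \<le> (q (x + s *\<^sub>R a) - s * q a) + (q (y + t *\<^sub>R a) - t * q a)"
      if "s \<ge> 0" "t \<ge> 0" for s t
      using lower[of "s + t" "x + y"] add[of "x + s *\<^sub>R a" "y + t *\<^sub>R a"] that
      by (simp add: algebra_simps)
    have "q' (x + y) - (q (x + s *\<^sub>R a) - s * q a) \<le> q' y" if "s \<ge> 0" for s
      using *[OF that] by (intro greatest) (simp add: algebra_simps)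
    then have "q' (x + y) - q' y \<le> q' x"
      by (intro greatest) (simp add: algebra_simps)
    then show "q' (x + y) \<le> q' x + q' y"
      by simp
  next
    fix c :: real and x assume c: "c > 0"
    have "q' (c *\<^sub>R x) / c \<le> q' x"
    proof (rule greatest)
      fix t :: real assume "t \<ge> 0"
      then have "q' (c *\<^sub>R x) \<le> c * (q (x + t *\<^sub>R a) - t * q a)"
        using lower[of "c * t" "c *\<^sub>R x"] scale[of c "x + t *\<^sub>R a"] c by (simp add: algebra_simps)
      then show "q' (c *\<^sub>R x) / c \<le> q (x + t *\<^sub>R a) - t * q a"
        using c by (simp add: divide_le_eq mult.commute)
    qed
    then show "q' (c *\<^sub>R x) \<le> c * q' x"
      using c by (simp add: divide_le_eq mult.commute)
  next
    have "(\<lambda>t. q (0 + t *\<^sub>R a) - t * q a) ` {0..} = (\<lambda>_. 0) ` {0::real..}"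
      by (rule image_cong) (simp_all add: scale)
    then show "q' 0 = 0" by (simp add: q'_def)
  qed
qed

text \<open>
  This is the Hahn-Banach theorem with the zero subspace as starting point.  A minimal sublinear functional
  below \<open>p\<close> coincides with each of its perturbations, hence is odd, and an odd sublinear functional is
  linear.
\<close>

lemma sublinear_minorant_linear:
  assumes p: "sublinear p"
  obtains f where "linear f" and "\<And>x. f x \<le> p x"
proof -
  define A where "A = {q. sublinear q \<and> q \<le> p}"
  have "\<exists>q\<in>A. \<forall>q'\<in>A. q' \<le> q \<longrightarrow> q' = q"
  proof (rule predicate_Zorn)
    show "partial_order_on A (relation_of (\<lambda>q q'. q' \<le> q) A)"
      by (rule partial_order_on_relation_ofI) auto
  next
    fix Q assume Q: "Q \<in> Chains (relation_of (\<lambda>q q'. q' \<le> q) A)"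
    then have QA: "q \<in> A" if "q \<in> Q" for q
      using that by (auto simp: Chains_def relation_of_def)
    show "\<exists>u\<in>A. \<forall>q\<in>Q. u \<le> q"
    proof (cases "Q = {}")
      case True
      then show ?thesis
        using p by (auto simp: A_def)
    next
      case False
      have sub: "\<And>q. q \<in> Q \<Longrightarrow> sublinear q" and le: "\<And>q x. q \<in> Q \<Longrightarrow> q x \<le> p x"
        using QA by (auto simp: A_def le_fun_def)
      have chain: "\<And>q1 q2. q1 \<in> Q \<Longrightarrow> q2 \<in> Q \<Longrightarrow> q1 \<le> q2 \<or> q2 \<le> q1"
        using Q by (auto simp: Chains_def relation_of_def)
      have inf: "sublinear (\<lambda>x. INF q\<in>Q. q x)" "\<And>q x. q \<in> Q \<Longrightarrow> (INF q\<in>Q. q x) \<le> q x"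
        using sublinear_INF_chain[of Q p] False sub le chain by blast+
      have "(\<lambda>x. INF q\<in>Q. q x) \<le> p"
        using inf(2) le False by (meson ex_in_conv le_funI order_trans)
      with inf show ?thesis
        by (intro bexI[of _ "\<lambda>x. INF q\<in>Q. q x"]) (auto simp: A_def intro: le_funI)
    qed
  qed
  then obtain q where q: "sublinear q" and "q \<le> p"
    and minimal: "\<And>q'. sublinear q' \<Longrightarrow> q' \<le> q \<Longrightarrow> q' = q"
    unfolding A_def by (auto intro: order_trans)
  have minus: "q (- a) = - q a" for a
  proof -
    define q' where "q' = (\<lambda>y. INF t\<in>{0..}. q (y + t *\<^sub>R a) - t * q a)"
    have pert: "sublinear q'" "\<And>t y. t \<ge> 0 \<Longrightarrow> q' y \<le> q (y + t *\<^sub>R a) - t * q a"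
      unfolding q'_def by (rule sublinear_perturbation[OF q])+
    have "q' = q"
      using pert(2)[of 0] by (intro minimal pert(1) le_funI) simp
    then have "q (- a) \<le> - q a"
      using pert(2)[of 1 "- a"] sublinearD(3)[OF q] by simp
    with sublinearD(4)[OF q, of a] show ?thesis by simp
  qed
  have "linear q"
  proof (rule linearI)
    fix x y
    show "q (x + y) = q x + q y"
      using sublinearD(1)[OF q, of x y] sublinearD(1)[OF q, of "x + y" "- y"] minus[of y] by simp
  next
    fix c x
    show "q (c *\<^sub>R x) = c *\<^sub>R q x"
      using sublinearD(2)[OF q, of c x] sublinearD(2)[OF q, of "- c" "- x"] minus[of x]
      by (cases "c \<ge> 0") auto
  qed
  with \<open>q \<le> p\<close> that show thesis by (auto simp: le_fun_def)
qed

text \<open>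
  The gauge \<open>p y = inf (\<parallel>y + t k\<parallel> - t d)\<close> over \<open>t \<ge> 0\<close> and \<open>k \<in> K\<close> encodes both requirements at once: \<open>t = 0\<close>
  gives \<open>p y \<le> \<parallel>y\<parallel>\<close>, so that linear functionals below \<open>p\<close> have norm at most 1, and \<open>t = 1\<close> gives
  \<open>p (- k) \<le> - d\<close>, so that they are at least \<open>d\<close> on \<open>K\<close>.  Convexity of \<open>K\<close> makes \<open>p\<close> subadditive, and the
  distance of \<open>K\<close> from the origin makes it finite.
\<close>

lemma separate_convex_from_ball:
  fixes K :: "'a::real_normed_vector set"
  assumes "convex K" and far: "\<And>k. k \<in> K \<Longrightarrow> d \<le> norm k"
  obtains f :: "'a \<Rightarrow>\<^sub>L real" where "norm f \<le> 1" and "\<And>k. k \<in> K \<Longrightarrow> d \<le> blinfun_apply f k"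
proof (cases "K = {}")
  case True
  then show ?thesis using that[of 0] by simp
next
  case False
  then obtain k0 where k0: "k0 \<in> K" by blast
  define I where "I = {0::real..} \<times> K"
  define p where "p y = (INF (t, k)\<in>I. norm (y + t *\<^sub>R k) - t * d)" for y
  have I: "I \<noteq> {}" using k0 by (auto simp: I_def)
  have bdd: "bdd_below ((\<lambda>(t, k). norm (y + t *\<^sub>R k) - t * d) ` I)" for y
  proof (rule bdd_belowI2)
    fix i assume "i \<in> I"
    then obtain t k where i: "i = (t, k)" "t \<ge> 0" "k \<in> K" by (auto simp: I_def)
    have "t * d \<le> norm (t *\<^sub>R k)"
      using far[OF \<open>k \<in> K\<close>] \<open>t \<ge> 0\<close> by (simp add: mult_left_mono)
    then show "- norm y \<le> (case i of (t, k) \<Rightarrow> norm (y + t *\<^sub>R k) - t * d)"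
      using norm_triangle_ineq4[of "y + t *\<^sub>R k" y] i by simp
  qed
  have lower: "p y \<le> norm (y + t *\<^sub>R k) - t * d" if "t \<ge> 0" "k \<in> K" for y t k
    unfolding p_def using cINF_lower[OF bdd, of "(t, k)" y] that by (simp add: I_def)
  have greatest: "b \<le> p y" if "\<And>t k. t \<ge> 0 \<Longrightarrow> k \<in> K \<Longrightarrow> b \<le> norm (y + t *\<^sub>R k) - t * d" for b y
    unfolding p_def using that by (intro cINF_greatest[OF I]) (auto simp: I_def)
  have "sublinear p"
  proof (rule sublinearI_le)
    fix x y
    have *: "p (x + y) \<le> (norm (x + s *\<^sub>R k) - s * d) + (norm (y + t *\<^sub>R l) - t * d)"
      if st: "s \<ge> 0" "t \<ge> 0" and kl: "k \<in> K" "l \<in> K" for s t k l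
    proof -
      obtain m where m: "m \<in> K" "(s + t) *\<^sub>R m = s *\<^sub>R k + t *\<^sub>R l"
      proof (cases "s + t = 0")
        case True
        with st k0 show ?thesis by (intro that[of k0]) (auto simp: add_nonneg_eq_0_iff)
      next
        case False
        have "(s / (s + t)) *\<^sub>R k + (t / (s + t)) *\<^sub>R l \<in> K"
          using \<open>convex K\<close> kl st False by (intro convexD) (auto simp: add_divide_distrib[symmetric])
        moreover have "(s + t) *\<^sub>R ((s / (s + t)) *\<^sub>R k + (t / (s + t)) *\<^sub>R l) = s *\<^sub>R k + t *\<^sub>R l"
          using False by (simp add: scaleR_right_distrib)
        ultimately show ?thesis using that by blast
      qed
      have "norm ((x + y) + (s + t) *\<^sub>R m) \<le> norm (x + s *\<^sub>R k) + norm (y + t *\<^sub>R l)"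
        using norm_triangle_ineq[of "x + s *\<^sub>R k" "y + t *\<^sub>R l"] m(2) by (simp add: algebra_simps)
      with lower[of "s + t" m "x + y"] m(1) st show ?thesis
        by (simp add: algebra_simps)
    qed
    have "p (x + y) - (norm (x + s *\<^sub>R k) - s * d) \<le> p y" if "s \<ge> 0" "k \<in> K" for s k
      using *[OF that(1) _ that(2)] by (intro greatest) (simp add: algebra_simps)
    then have "p (x + y) - p y \<le> p x"
      by (intro greatest) (simp add: algebra_simps)
    then show "p (x + y) \<le> p x + p y" by simp
  next
    fix c :: real and x assume c: "c > 0"
    have "p (c *\<^sub>R x) / c \<le> p x"
    proof (rule greatest)
      fix t :: real and k assume "t \<ge> 0" "k \<in> K"
      have "norm (c *\<^sub>R x + (c * t) *\<^sub>R k) = c * norm (x + t *\<^sub>R k)"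
        using c norm_scaleR[of c "x + t *\<^sub>R k"] by (simp add: scaleR_right_distrib)
      then have "p (c *\<^sub>R x) \<le> c * (norm (x + t *\<^sub>R k) - t * d)"
        using lower[of "c * t" k "c *\<^sub>R x"] \<open>t \<ge> 0\<close> \<open>k \<in> K\<close> c by (simp add: algebra_simps)
      then show "p (c *\<^sub>R x) / c \<le> norm (x + t *\<^sub>R k) - t * d"
        using c by (simp add: divide_le_eq mult.commute)
    qed
    then show "p (c *\<^sub>R x) \<le> c * p x"
      using c by (simp add: divide_le_eq mult.commute)
  next
    show "p 0 = 0"
    proof (rule antisym)
      show "p 0 \<le> 0" using lower[of 0 k0 0] k0 by simp
      show "0 \<le> p 0" using far by (intro greatest) (simp add: mult_left_mono)
    qed
  qed
  then obtain f where "linear f" and fp: "\<And>x. f x \<le> p x"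
    by (rule sublinear_minorant_linear) blast
  interpret linear f by fact
  have f_le: "f x \<le> norm x" for x
    using fp[of x] lower[of 0 k0 x] k0 by simp
  have abs_le: "norm (f x) \<le> 1 * norm x" for x
    using f_le[of x] f_le[of "- x"] neg[of x] by simp
  have "bounded_linear f"
    using abs_le by (intro bounded_linear_intro[where K=1]) (simp_all add: add scale mult.commute)
  then have apply_f: "blinfun_apply (Blinfun f) = f"
    by (rule bounded_linear_Blinfun_apply)
  show ?thesis
  proof (rule that)
    show "norm (Blinfun f) \<le> 1"
      using abs_le by (intro norm_blinfun_bound) (simp_all add: apply_f)
    show "d \<le> blinfun_apply (Blinfun f) k" if "k \<in> K" for k
      using fp[of "- k"] lower[of 1 k "- k"] that neg[of k] by (simp add: apply_f)
  qed
qed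

lemma blinfun_near_norm:
  fixes A :: "'a::real_normed_vector \<Rightarrow>\<^sub>L 'b::real_normed_vector"
  assumes "m < norm A"
  obtains v where "norm v \<le> 1" and "m < norm (blinfun_apply A v)"
proof (cases "m < 0")
  case True
  then show ?thesis using that[of 0] by simp
next
  case False
  have "\<exists>x. \<not> norm (blinfun_apply A x) \<le> m * norm x"
    using norm_blinfun_bound[of m A] assms False by force
  then obtain x where x: "m * norm x < norm (blinfun_apply A x)"
    by (auto simp: not_le)
  then have "x \<noteq> 0" by auto
  then show ?thesis
    using x that[of "inverse (norm x) *\<^sub>R x"]
    by (simp add: blinfun.scaleR_right field_simps)
qed

text \<open>
  The proof is a gliding hump.  If the norms are unbounded, choose operators \<open>A n\<close> with norm above
  \<open>4 ^ n\<close> and move from \<open>x n\<close> by at most \<open>(1/3) ^ (n + 1)\<close> to a point where \<open>A n\<close> is large.  All later moves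
  together shift the point by at most half of that, which cannot destroy the gain, so the values of
  the \<open>A n\<close> at the limit point are unbounded.
\<close>

theorem uniform_boundedness:
  fixes F :: "('a::banach \<Rightarrow>\<^sub>L 'b::real_normed_vector) set"
  assumes pointwise: "\<And>x. bounded ((\<lambda>A. blinfun_apply A x) ` F)"
  shows "bounded F"
proof (rule ccontr)
  assume "\<not> bounded F"
  then have "\<exists>A\<in>F. 4 ^ n < norm A" for n :: nat
    unfolding bounded_iff by (meson not_le)
  then obtain A where AF: "\<And>n. A n \<in> F" and A: "\<And>n. 4 ^ n < norm (A n)"
    by metis
  have hump: "\<exists>y. norm (y - x) \<le> r \<and> r * m \<le> norm (blinfun_apply B y)"
    if "r > 0" "m < norm B" for x r m and B :: "'a \<Rightarrow>\<^sub>L 'b"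
  proof -
    obtain v where v: "norm v \<le> 1" "m < norm (blinfun_apply B v)"
      using blinfun_near_norm[OF \<open>m < norm B\<close>] .
    \<comment> \<open>the two points \<open>x + r v\<close> and \<open>x - r v\<close> differ by \<open>2 r v\<close>, so at one of them \<open>B\<close> has size at least \<open>r \<parallel>B v\<parallel>\<close>\<close>
    have "norm (blinfun_apply B (2 *\<^sub>R r *\<^sub>R v)) \<le>
        norm (blinfun_apply B (x + r *\<^sub>R v)) + norm (blinfun_apply B (x - r *\<^sub>R v))"
      using norm_triangle_ineq4[of "blinfun_apply B (x + r *\<^sub>R v)" "blinfun_apply B (x - r *\<^sub>R v)"]
      by (simp flip: blinfun.diff_right scaleR_2)
    moreover have "norm (blinfun_apply B (2 *\<^sub>R r *\<^sub>R v)) = 2 * (r * norm (blinfun_apply B v))"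
      using \<open>r > 0\<close> by (simp add: blinfun.scaleR_right)
    moreover have "r * m \<le> r * norm (blinfun_apply B v)"
      using v \<open>r > 0\<close> by simp
    ultimately consider "r * m \<le> norm (blinfun_apply B (x + r *\<^sub>R v))"
      | "r * m \<le> norm (blinfun_apply B (x - r *\<^sub>R v))"
      by linarith
    then show ?thesis
    proof cases
      case 1
      with v \<open>r > 0\<close> show ?thesis
        by (intro exI[of _ "x + r *\<^sub>R v"]) (simp add: mult_left_le)
    next
      case 2
      with v \<open>r > 0\<close> show ?thesis
        by (intro exI[of _ "x - r *\<^sub>R v"]) (simp add: mult_left_le)
    qed
  qed
  define r where "r n = (1 / 3 :: real) ^ n" for n
  have "\<exists>x. \<forall>n. norm (x (Suc n) - x n) \<le> r (Suc n) \<and> r (Suc n) * (3 / 4 * norm (A n)) \<le> norm (blinfun_apply (A n) (x (Suc n)))"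
  proof (rule dependent_nat_choice[where P="\<lambda>_ _. True", simplified])
    fix x n
    have "norm (A n) > 0" using A[of n] by (rule order_le_less_trans[rotated]) simp
    then show "\<exists>y. norm (y - x) \<le> r (Suc n) \<and> r (Suc n) * (3 / 4 * norm (A n)) \<le> norm (blinfun_apply (A n) y)"
      by (intro hump) (simp_all add: r_def)
  qed
  then obtain x where x1: "\<And>n. norm (x (Suc n) - x n) \<le> r (Suc n)"
    and x2: "\<And>n. r (Suc n) * (3 / 4 * norm (A n)) \<le> norm (blinfun_apply (A n) (x (Suc n)))"
    by blast
  have dist: "norm (x (n + k) - x n) \<le> r n / 2 - r (n + k) / 2" for n k
  proof (induction k)
    case (Suc k)
    have "norm (x (n + Suc k) - x n) \<le> norm (x (Suc (n + k)) - x (n + k)) + norm (x (n + k) - x n)"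
      using norm_triangle_ineq[of "x (Suc (n + k)) - x (n + k)" "x (n + k) - x n"] by simp
    also have "\<dots> \<le> r (Suc (n + k)) + (r n / 2 - r (n + k) / 2)"
      using x1 Suc by (intro add_mono)
    finally show ?case by (simp add: r_def)
  qed simp
  have r_lim: "r \<longlonglongrightarrow> 0"
    unfolding r_def by (rule LIMSEQ_power_zero) simp
  have r_pos: "r n > 0" for n by (simp add: r_def)
  have dist': "norm (x m - x n) \<le> r n / 2" if "n \<le> m" for n m
    using dist[of n "m - n"] that r_pos[of m] by simp
  have "Cauchy x"
  proof (rule metric_CauchyI)
    fix e :: real assume "e > 0"
    then obtain N where N: "\<And>n. n \<ge> N \<Longrightarrow> r n < e"
      using order_tendstoD(2)[OF r_lim] by (auto simp: eventually_sequentially)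
    have "dist (x m) (x n) < e" if "m \<ge> N" "n \<ge> N" for m n
      using norm_triangle_ineq4[of "x m - x N" "x n - x N"] dist'[OF that(1)] dist'[OF that(2)] N[of N]
      by (simp add: dist_norm)
    then show "\<exists>N. \<forall>m\<ge>N. \<forall>n\<ge>N. dist (x m) (x n) < e" by blast
  qed
  then obtain z where z: "x \<longlonglongrightarrow> z"
    using Cauchy_convergent convergent_def by blast
  have zx: "norm (z - x n) \<le> r n / 2" for n
    using z dist'
    by (intro LIMSEQ_le_const2[OF tendsto_norm[OF tendsto_diff[OF z tendsto_const]]]) auto
  obtain b where b: "\<And>B. B \<in> F \<Longrightarrow> norm (blinfun_apply B z) \<le> b"
    using pointwise[of z] by (auto simp: bounded_iff)
  have growth: "(4 / 3) ^ n / 12 \<le> b" for n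
  proof -
    have "norm (blinfun_apply (A n) (x (Suc n))) \<le>
        norm (blinfun_apply (A n) z) + norm (blinfun_apply (A n) (z - x (Suc n)))"
      using norm_triangle_ineq4[of "blinfun_apply (A n) z" "blinfun_apply (A n) (z - x (Suc n))"]
      by (simp flip: blinfun.diff_right)
    moreover have "norm (blinfun_apply (A n) (z - x (Suc n))) \<le> norm (A n) * (r (Suc n) / 2)"
      using norm_blinfun[of "A n" "z - x (Suc n)"] mult_left_mono[OF zx norm_ge_zero] by (rule order_trans)
    ultimately have "r (Suc n) * norm (A n) / 4 \<le> norm (blinfun_apply (A n) z)"
      using x2[of n] by (simp add: algebra_simps)
    also have "\<dots> \<le> b" using b AF by blast
    finally have "r (Suc n) * norm (A n) / 4 \<le> b" .
    moreover have "r (Suc n) * 4 ^ n \<le> r (Suc n) * norm (A n)"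
      using A[of n] r_pos[of "Suc n"] by simp
    ultimately show ?thesis by (simp add: r_def power_divide)
  qed
  obtain n where "12 * b < (4 / 3 :: real) ^ n"
    using real_arch_pow[of "4/3" "12 * b"] by auto
  with growth[of n] show False by simp
qed

section \<open>Functionals over the scalar field\<close>

text \<open>
  The scalar field is known only through the existence of an embedding into the complex numbers; the real part
  is taken along a chosen one.
\<close>

definition scalar_re :: "'k::real_or_complex \<Rightarrow> real"
  where "scalar_re a = Re ((SOME h :: 'k \<Rightarrow> complex.
    h 1 = 1 \<and> (\<forall>a b. h (a + b) = h a + h b) \<and> (\<forall>a b. h (a * b) = h a * h b) \<and>
    (\<forall>r a. h (r *\<^sub>R a) = r *\<^sub>R h a) \<and> (\<forall>a. norm (h a) = norm a)) a)"

lemma scalar_re_embedding: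
  obtains h :: "'k::real_or_complex \<Rightarrow> complex" where "h 1 = 1" and "\<And>a b. h (a + b) = h a + h b"
    and "\<And>a b. h (a * b) = h a * h b" and "\<And>r a. h (r *\<^sub>R a) = r *\<^sub>R h a"
    and "\<And>a. norm (h a) = norm a" and "\<And>a. scalar_re a = Re (h a)"
proof -
  define h :: "'k \<Rightarrow> complex" where "h = (SOME h :: 'k \<Rightarrow> complex.
    h 1 = 1 \<and> (\<forall>a b. h (a + b) = h a + h b) \<and> (\<forall>a b. h (a * b) = h a * h b) \<and>
    (\<forall>r a. h (r *\<^sub>R a) = r *\<^sub>R h a) \<and> (\<forall>a. norm (h a) = norm a))"
  have "h 1 = 1 \<and> (\<forall>a b. h (a + b) = h a + h b) \<and> (\<forall>a b. h (a * b) = h a * h b) \<and>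
    (\<forall>r a. h (r *\<^sub>R a) = r *\<^sub>R h a) \<and> (\<forall>a. norm (h a) = norm a)"
    unfolding h_def by (rule someI_ex[OF complex_embedding])
  moreover have "scalar_re a = Re (h a)" for a :: 'k
    by (simp add: scalar_re_def h_def)
  ultimately show thesis using that by blast
qed

lemma scalar_re_of_real [simp]: "scalar_re (of_real r :: 'k::real_or_complex) = r"
proof -
  obtain h :: "'k \<Rightarrow> complex" where h: "h 1 = 1" "\<And>r a. h (r *\<^sub>R a) = r *\<^sub>R h a"
    "\<And>a. scalar_re a = Re (h a)"
    by (rule scalar_re_embedding) blast
  show ?thesis by (simp add: h of_real_def)
qed

lemma scalar_re_le_norm: "\<bar>scalar_re (a :: 'k::real_or_complex)\<bar> \<le> norm a"
proof -
  obtain h :: "'k \<Rightarrow> complex" where h: "\<And>a. norm (h a) = norm a" "\<And>a. scalar_re a = Re (h a)"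
    by (rule scalar_re_embedding) blast
  show ?thesis using abs_Re_le_cmod[of "h a"] by (simp add: h)
qed

lemma bounded_linear_scalar_re: "bounded_linear (scalar_re :: 'k::real_or_complex \<Rightarrow> real)"
proof -
  obtain h :: "'k \<Rightarrow> complex" where h: "\<And>a b. h (a + b) = h a + h b"
    "\<And>r a. h (r *\<^sub>R a) = r *\<^sub>R h a" "\<And>a. scalar_re a = Re (h a)"
    by (rule scalar_re_embedding) blast
  show ?thesis
    by (rule bounded_linear_intro[where K=1]) (simp_all add: h(1,2,3)[symmetric] scalar_re_le_norm, simp_all add: h)
qed

text \<open>
  Rotating the argument of a linear functional by such a scalar turns estimates of its real part into
  estimates of its absolute value.
\<close>

lemma unimodular_rotation:
  fixes a :: "'k::real_normed_field"
  obtains c where "norm c = 1" and "c * a = of_real (norm a)"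
proof (cases "a = 0")
  case True
  then show ?thesis using that[of 1] by simp
next
  case False
  then show ?thesis using that[of "of_real (norm a) / a"] by (simp add: norm_divide)
qed

lemma dual_op_in_dual_space:
  "A \<in> bounded_ops scaleU scaleX \<Longrightarrow> x' \<in> dual_space scaleX \<Longrightarrow> dual_op A x' \<in> dual_space scaleU"
  by (simp add: dual_space_def bounded_ops_def dual_op_def)

lemma dual_op_dual_op: "dual_op B (dual_op A x') = dual_op (A o\<^sub>L B) x'"
  by (rule blinfun_eqI) (simp add: dual_op_def)

context normed_space_over
begin

lemma dual_rotate:
  assumes "x' \<in> dual_space scl"
  obtains y where "norm y = norm x" and "scalar_re (blinfun_apply x' y) = norm (blinfun_apply x' x)"
proof -
  obtain c where c: "norm c = 1" "c * blinfun_apply x' x = of_real (norm (blinfun_apply x' x))"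
    by (rule unimodular_rotation)
  have "blinfun_apply x' (scl c x) = of_real (norm (blinfun_apply x' x))"
    using assms c(2) by (simp add: dual_space_def bounded_ops_def)
  then show ?thesis
    using that[of "scl c x"] c(1) by (simp add: norm_scale)
qed

lemma dual_near_norm:
  assumes "x' \<in> dual_space scl" and "m < norm x'"
  obtains v where "norm v \<le> 1" and "m < scalar_re (blinfun_apply x' v)"
proof -
  obtain w where w: "norm w \<le> 1" "m < norm (blinfun_apply x' w)"
    using blinfun_near_norm[OF assms(2)] .
  obtain v where "norm v = norm w" "scalar_re (blinfun_apply x' v) = norm (blinfun_apply x' w)"
    by (rule dual_rotate[OF assms(1)])
  with w that[of v] show ?thesis by simp
qed

lemma dual_norm_le:
  assumes "x' \<in> dual_space scl" and "b \<ge> 0" and "\<And>x. scalar_re (blinfun_apply x' x) \<le> b * norm x"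
  shows "norm x' \<le> b"
proof (rule norm_blinfun_bound[OF \<open>b \<ge> 0\<close>])
  fix x
  obtain y where "norm y = norm x" "scalar_re (blinfun_apply x' y) = norm (blinfun_apply x' x)"
    by (rule dual_rotate[OF assms(1)])
  with assms(3)[of y] show "norm (blinfun_apply x' x) \<le> b * norm x" by simp
qed

text \<open>
  Real functionals from the separation argument have to be turned into elements of the dual space.  If the
  field contains an element \<open>j\<close> with square \<open>-1\<close>, the usual formula \<open>x' x = f x - j f (j x)\<close> applies;
  otherwise the field consists of the reals only and \<open>f\<close> is already linear over it.  The norm does not grow, by a
  rotation.
\<close>

lemma functional_with_real_part:
  fixes f :: "'v \<Rightarrow>\<^sub>L real"
  obtains x' where "x' \<in> dual_space scl" and "\<And>x. scalar_re (blinfun_apply x' x) = blinfun_apply f x"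
    and "norm x' \<le> norm f"
proof -
  obtain h :: "'k \<Rightarrow> complex" where h1: "h 1 = 1" and h_add: "\<And>a b. h (a + b) = h a + h b"
    and h_mult: "\<And>a b. h (a * b) = h a * h b" and h_scaleR: "\<And>r a. h (r *\<^sub>R a) = r *\<^sub>R h a"
    and h_norm: "\<And>a. norm (h a) = norm a" and h_re: "\<And>a. scalar_re a = Re (h a)"
    by (rule scalar_re_embedding) blast
  have h_of_real: "h (of_real r) = of_real r" for r
    using h_scaleR[of r 1] h1 by (simp add: of_real_def)
  have h_diff: "h (a - b) = h a - h b" for a b
    using h_add[of "a - b" b] by simp
  have h_inj: "a = b" if "h a = h b" for a b
    using h_norm[of "a - b"] h_diff[of a b] that by simp
  have scl_add: "scl (a + b) x = scl a x + scl b x" and scl_scl: "scl a (scl b x) = scl (a * b) x" 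
    and scl_addx: "scl a (x + y) = scl a x + scl a y" for a b x y
    by (simp_all add: scale_left_distrib scale_right_distrib)
  have ex: "\<exists>g. (\<forall>x y. g (x + y) = g x + g y) \<and> (\<forall>c x. g (scl c x) = c * g x) \<and> (\<forall>x. scalar_re (g x) = blinfun_apply f x)"
  proof (cases "\<exists>a. Im (h a) \<noteq> 0")
    case True
    then obtain a where a: "Im (h a) \<noteq> 0" by blast
    define j where "j = (inverse (Im (h a))) *\<^sub>R (a - of_real (Re (h a)))"
    have hj: "h j = \<i>"
      using a by (simp add: j_def h_scaleR h_diff h_of_real complex_eq_iff)
    have jj: "j * j = - 1"
      using h_diff[of 0 1] h_diff[of 1 1] by (intro h_inj) (simp add: h_mult hj h1)
    \<comment> \<open>hence the field is spanned by \<open>1\<close> and \<open>j\<close> over the reals\<close>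
    have decomp: "c = of_real (Re (h c)) + of_real (Im (h c)) * j" for c
      by (intro h_inj) (simp add: h_add h_mult h_of_real hj complex_eq_iff)
    define g where "g x = of_real (blinfun_apply f x) - j * of_real (blinfun_apply f (scl j x))" for x
    have g_add: "g (x + y) = g x + g y" for x y
      by (simp add: g_def scl_addx blinfun.add_right algebra_simps)
    have g_real: "g (scl (of_real r) x) = of_real r * g x" for r x
    proof -
      have "scl j (scl (of_real r) x) = r *\<^sub>R scl j x"
        by (metis mult.commute scale_of_real scl_scl)
      then show ?thesis
        by (simp add: g_def scale_of_real blinfun.scaleR_right algebra_simps)
    qed
    have g_j: "g (scl j x) = j * g x" for x
    proof -
      have "scl j (scl j x) = - x"
        using scale_minus_left[of 1 x] by (simp add: jj)
      moreover have "j * (j * of_real s) = - of_real s" for s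
        using jj by (simp add: mult.assoc[symmetric])
      ultimately show ?thesis
        by (simp add: g_def blinfun.minus_right right_diff_distrib)
    qed
    have "g (scl c x) = c * g x" for c x
    proof -
      have "g (scl c x) = g (scl (of_real (Re (h c))) x + scl (of_real (Im (h c))) (scl j x))"
        by (subst decomp[of c]) (simp add: scl_add)
      also have "\<dots> = of_real (Re (h c)) * g x + of_real (Im (h c)) * (j * g x)"
        by (simp only: g_add g_real g_j)
      also have "\<dots> = c * g x"
        by (subst (3) decomp[of c]) (simp add: algebra_simps)
      finally show ?thesis .
    qed
    moreover have "scalar_re (g x) = blinfun_apply f x" for x
      by (simp add: h_re g_def h_diff h_mult h_of_real hj)
    ultimately show ?thesis using g_add by blast
  next
    case False
    then have real: "c = of_real (Re (h c))" for c
      by (intro h_inj) (simp add: h_of_real complex_eq_iff)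
    define g where "g x = (of_real (blinfun_apply f x)   :: 'k)" for x
    have "g (scl c x) = c * g x" for c x
      by (subst (1 2) real) (simp add: g_def scale_of_real blinfun.scaleR_right)
    then show ?thesis
      by (intro exI[of _ g]) (simp add: g_def blinfun.add_right)
  qed
  then obtain g where g: "\<And>x y. g (x + y) = g x + g y" "\<And>c x. g (scl c x) = c * g x"
    "\<And>x. scalar_re (g x) = blinfun_apply f x"
    by blast
  have bound: "norm (g x) \<le> norm x * norm f" for x
  proof -
    obtain c where c: "norm c = 1" "c * g x = of_real (norm (g x))"
      by (rule unimodular_rotation)
    have "norm (g x) = blinfun_apply f (scl c x)"
      using c(2) by (simp flip: g(3) add: g(2))
    also have "\<dots> \<le> norm f * norm (scl c x)"
      using norm_blinfun[of f "scl c x"] by simp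
    finally show ?thesis by (simp add: norm_scale c(1) mult.commute)
  qed
  have "bounded_linear g"
  proof (rule bounded_linear_intro[OF g(1) _ bound])
    show "g (r *\<^sub>R x) = r *\<^sub>R g x" for r x
      using g(2)[of "of_real r" x] by (simp add: scale_of_real scaleR_conv_of_real)
  qed
  then have app: "blinfun_apply (Blinfun g) = g"
    by (rule bounded_linear_Blinfun_apply)
  show ?thesis
  proof (rule that)
    show "Blinfun g \<in> dual_space scl"
      by (simp add: dual_space_def bounded_ops_def app g(2))
    show "scalar_re (blinfun_apply (Blinfun g) x) = blinfun_apply f x" for x
      by (simp add: app g(3))
    show "norm (Blinfun g) \<le> norm f"
      using bound by (intro norm_blinfun_bound) (simp_all add: app mult.commute)
  qed
qed

end

section \<open>Local boundedness and continuity of semigroups\<close>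

lemma C0_semigroup_continuous_at_0:
  assumes S: "C0_semigroup scl S" and "e > 0"
  obtains d where "d > 0" and "\<And>t. 0 \<le> t \<Longrightarrow> t < d \<Longrightarrow> norm (blinfun_apply (S t) x - x) < e"
proof -
  have "((\<lambda>t. blinfun_apply (S t) x) \<longlongrightarrow> x) (at_right 0)" and S0: "S 0 = id_blinfun"
    using S by (simp_all add: C0_semigroup_def)
  then have "\<forall>\<^sub>F t in at_right 0. dist (blinfun_apply (S t) x) x < e"
    using \<open>e > 0\<close> by (simp add: tendsto_iff)
  then obtain d where d: "d > 0" "\<And>t. 0 < t \<Longrightarrow> t < d \<Longrightarrow> dist (blinfun_apply (S t) x) x < e"
    by (auto simp: eventually_at_right_field)
  show ?thesis
  proof (rule that[OF d(1)])
    show "norm (blinfun_apply (S t) x - x) < e" if "0 \<le> t" "t < d" for t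
      using d(2)[of t] that \<open>e > 0\<close> S0 by (cases "t = 0") (simp_all add: dist_norm)
  qed
qed

text \<open>
  Near 0 the operators are bounded, since otherwise a sequence of times tending to 0 would contradict the
  uniform boundedness principle.  The semigroup law carries the bound to every compact interval.
\<close>

lemma C0_semigroup_bounded:
  fixes S :: "real \<Rightarrow> ('x::banach \<Rightarrow>\<^sub>L 'x)"
  assumes S: "C0_semigroup scl S"
  obtains M where "M \<ge> 0" and "\<And>t. 0 \<le> t \<Longrightarrow> t \<le> T \<Longrightarrow> norm (S t) \<le> M"
proof -
  have S0: "S 0 = id_blinfun" and S_add: "\<And>s t. s \<ge> 0 \<Longrightarrow> t \<ge> 0 \<Longrightarrow> S (s + t) = S s o\<^sub>L S t"
    using S by (simp_all add: C0_semigroup_def)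
  have "\<exists>d>0. \<exists>K. \<forall>t. 0 \<le> t \<longrightarrow> t \<le> d \<longrightarrow> norm (S t) \<le> K"
  proof (rule ccontr)
    assume neg: "\<not> ?thesis"
    have "\<exists>t. 0 \<le> t \<and> t \<le> 1 / real (Suc n) \<and> real n < norm (S t)" for n
      using neg[simplified, rule_format, of "1 / real (Suc n)" "real n"] by (auto simp: not_le)
    then obtain t where t: "\<And>n. 0 \<le> t n" "\<And>n. t n \<le> 1 / real (Suc n)" "\<And>n. real n < norm (S (t n))"
      by metis
    have t0: "t \<longlonglongrightarrow> 0"
      by (rule tendsto_sandwich[OF _ _ tendsto_const LIMSEQ_inverse_real_of_nat])
        (use t(1,2) in \<open>auto simp: inverse_eq_divide\<close>)
    have "bounded ((\<lambda>A. blinfun_apply A x) ` range (\<lambda>n. S (t n)))" for x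
    proof -
      have "(\<lambda>n. blinfun_apply (S (t n)) x) \<longlonglongrightarrow> x"
        unfolding tendsto_iff
      proof (intro allI impI)
        fix e :: real assume "e > 0"
        obtain d where d: "d > 0" "\<And>t. 0 \<le> t \<Longrightarrow> t < d \<Longrightarrow> norm (blinfun_apply (S t) x - x) < e"
          using C0_semigroup_continuous_at_0[OF S \<open>e > 0\<close>, of x] by metis
        show "\<forall>\<^sub>F n in sequentially. dist (blinfun_apply (S (t n)) x) x < e"
          using order_tendstoD(2)[OF t0 d(1)] by (rule eventually_mono) (simp add: dist_norm d(2) t(1))
      qed
      from convergent_imp_bounded[OF this] show ?thesis by (simp add: image_image)
    qed
    then have "bounded (range (\<lambda>n. S (t n)))"
      by (rule uniform_boundedness)
    then obtain b where b: "\<And>n. norm (S (t n)) \<le> b"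
      by (auto simp: bounded_iff)
    obtain n :: nat where "b < real n" using reals_Archimedean2 by blast
    with b[of n] t(3)[of n] show False by simp
  qed
  then obtain d K0 where "d > 0" and K0: "\<And>t. 0 \<le> t \<Longrightarrow> t \<le> d \<Longrightarrow> norm (S t) \<le> K0"
    by blast
  define K where "K = max 1 K0"
  have K: "K \<ge> 1" "\<And>t. 0 \<le> t \<Longrightarrow> t \<le> d \<Longrightarrow> norm (S t) \<le> K"
    using K0 by (auto simp: K_def le_max_iff_disj)
  have pow: "norm (S t) \<le> K ^ n" if "0 \<le> t" "t \<le> real n * d" for n t
    using that
  proof (induction n arbitrary: t)
    case 0
    then have "t = 0" by simp
    then show ?case by (simp add: S0 norm_blinfun_id_le)
  next
    case (Suc n)
    show ?case
    proof (cases "t \<le> d")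
      case True
      have "K * 1 \<le> K * K ^ n"
        using K(1) by (intro mult_left_mono) simp_all
      with K(2)[OF Suc.prems(1) True] show ?thesis by simp
    next
      case False
      have "norm (S (d + (t - d))) \<le> norm (S d) * norm (S (t - d))"
        using S_add[of d "t - d"] False \<open>d > 0\<close> norm_blinfun_compose[of "S d" "S (t - d)"] by simp
      also have "\<dots> \<le> K * K ^ n"
        using K \<open>d > 0\<close> Suc False by (intro mult_mono) (simp_all add: algebra_simps)
      finally show ?thesis by simp
    qed
  qed
  obtain n :: nat where "T / d < real n" using reals_Archimedean2 by blast
  then have "T \<le> real n * d" using \<open>d > 0\<close> by (simp add: divide_less_eq)
  with pow[of _ n] K(1) show thesis
    by (intro that[of "K ^ n"]) auto
qed

text \<open>
  Right continuity at 0 suffices because \<open>S t x - S s x = S s (S (t - s) x - x)\<close> for \<open>s \<le> t\<close>, where the norm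
  of \<open>S s\<close> is bounded on the interval.
\<close>

lemma C0_semigroup_strongly_continuous:
  fixes S :: "real \<Rightarrow> ('x::banach \<Rightarrow>\<^sub>L 'x)"
  assumes S: "C0_semigroup scl S"
  shows "continuous_on {0..T} (\<lambda>t. blinfun_apply (S t) x)"
proof -
  have S_add: "\<And>s t. s \<ge> 0 \<Longrightarrow> t \<ge> 0 \<Longrightarrow> S (s + t) = S s o\<^sub>L S t"
    using S by (simp add: C0_semigroup_def)
  obtain M where M: "M \<ge> 0" "\<And>t. 0 \<le> t \<Longrightarrow> t \<le> T \<Longrightarrow> norm (S t) \<le> M"
    using C0_semigroup_bounded[OF S] by metis
  have step: "norm (blinfun_apply (S t) x - blinfun_apply (S s) x) \<le> M * norm (blinfun_apply (S (t - s)) x - x)"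
    if "0 \<le> s" "s \<le> t" "t \<le> T" for s t
  proof -
    have "blinfun_apply (S t) x - blinfun_apply (S s) x = blinfun_apply (S s) (blinfun_apply (S (t - s)) x - x)"
      using S_add[of s "t - s"] that by (simp add: blinfun.diff_right)
    also have "norm \<dots> \<le> norm (S s) * norm (blinfun_apply (S (t - s)) x - x)"
      by (rule norm_blinfun)
    also have "\<dots> \<le> M * norm (blinfun_apply (S (t - s)) x - x)"
      using M(2)[of s] that by (intro mult_right_mono) auto
    finally show ?thesis .
  qed
  show ?thesis
    unfolding continuous_on_iff
  proof (intro ballI allI impI)
    fix s e :: real assume s: "s \<in> {0..T}" and "e > 0"
    obtain d where d: "d > 0" "\<And>t. 0 \<le> t \<Longrightarrow> t < d \<Longrightarrow> norm (blinfun_apply (S t) x - x) < e / (M + 1)"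
      using C0_semigroup_continuous_at_0[OF S, of "e / (M + 1)" x] \<open>e > 0\<close> M(1) by auto
    have small: "M * norm (blinfun_apply (S r) x - x) < e" if "0 \<le> r" "r < d" for r
    proof -
      have "M * norm (blinfun_apply (S r) x - x) \<le> M * (e / (M + 1))"
        using d(2)[OF that] M(1) by (intro mult_left_mono) auto
      also have "\<dots> < e"
        using \<open>e > 0\<close> M(1) by (simp add: field_simps)
      finally show ?thesis .
    qed
    have "dist (blinfun_apply (S t) x) (blinfun_apply (S s) x) < e" if t: "t \<in> {0..T}" "dist t s < d" for t
    proof (cases "s \<le> t")
      case True
      then show ?thesis
        using step[of s t] small[of "t - s"] s t by (simp add: dist_norm)
    next
      case False
      then show ?thesis
        using step[of t s] small[of "s - t"] s t by (simp add: dist_norm norm_minus_commute)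
    qed
    with d(1) show "\<exists>d>0. \<forall>t\<in>{0..T}. dist t s < d \<longrightarrow> dist (blinfun_apply (S t) x) (blinfun_apply (S s) x) < e"
      by blast
  qed
qed

section \<open>The Bochner integral of strongly measurable functions\<close>

text \<open>
  Strong measurability controls a function only up to null sets, so measurability of derived scalar
  functions needs a complete measure.
\<close>

lemma (in complete_measure) borel_measurable_AE_eq:
  fixes f g :: "'a \<Rightarrow> 'b::topological_space"
  assumes f: "f \<in> borel_measurable M" and eq: "AE x in M. f x = g x"
  shows "g \<in> borel_measurable M"
proof (rule borel_measurableI)
  fix A :: "'b set" assume "open A"
  then have "f -` A \<inter> space M \<in> sets M"
    using f by (intro measurable_sets) auto
  moreover have "AE x in M. x \<in> f -` A \<inter> space M \<longleftrightarrow> x \<in> g -` A \<inter> space M"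
    using eq by eventually_elim auto
  ultimately show "g -` A \<inter> space M \<in> sets M"
    using in_sets_AE by blast
qed

lemma (in complete_measure) borel_measurable_AE_LIMSEQ:
  fixes f :: "nat \<Rightarrow> 'a \<Rightarrow> 'b::{banach, second_countable_topology}"
  assumes f: "\<And>i. f i \<in> borel_measurable M" and lim: "AE x in M. (\<lambda>i. f i x) \<longlonglongrightarrow> g x"
  shows "g \<in> borel_measurable M"
proof (rule borel_measurable_AE_eq)
  show "(\<lambda>x. lim (\<lambda>i. f i x)) \<in> borel_measurable M"
    using f by (rule borel_measurable_lim_metric)
  show "AE x in M. lim (\<lambda>i. f i x) = g x"
    using lim by eventually_elim (rule limI)
qed

lemma strongly_measurable_simple: "simple_function M s \<Longrightarrow> strongly_measurable M s"
  unfolding strongly_measurable_def by (intro exI[of _ "\<lambda>_. s"]) simp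

lemma strongly_measurable_const: "strongly_measurable M (\<lambda>_. c)"
  by (rule strongly_measurable_simple) simp

lemma strongly_measurable_borel:
  fixes f :: "'a \<Rightarrow> 'b::{real_normed_vector, second_countable_topology}"
  assumes "f \<in> borel_measurable M"
  shows "strongly_measurable M f"
proof -
  obtain s where "\<And>i. simple_function M (s i)" and "\<And>x. x \<in> space M \<Longrightarrow> (\<lambda>i. s i x) \<longlonglongrightarrow> f x"
    using borel_measurable_implies_sequence_metric[OF assms, of 0] by metis
  then show ?thesis
    unfolding strongly_measurable_def by (intro exI[of _ s]) auto
qed

text \<open>
  Besides sums and products this covers the integrand \<open>F t (u t)\<close> of the controllability map, with the
  identity on the time axis as first argument.
\<close>

lemma strongly_measurable_compose2:
  fixes f :: "'a \<Rightarrow> 'b::real_normed_vector" and g :: "'a \<Rightarrow> 'c::real_normed_vector"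
  assumes f: "strongly_measurable M f" and g: "strongly_measurable M g"
    and p: "continuous_on UNIV (\<lambda>(x, y). p x y)"
  shows "strongly_measurable M (\<lambda>t. p (f t) (g t))"
proof -
  obtain s where s: "\<And>i. simple_function M (s i)" "AE t in M. (\<lambda>i. s i t) \<longlonglongrightarrow> f t"
    using f unfolding strongly_measurable_def by blast
  obtain s' where s': "\<And>i. simple_function M (s' i)" "AE t in M. (\<lambda>i. s' i t) \<longlonglongrightarrow> g t"
    using g unfolding strongly_measurable_def by blast
  have "AE t in M. (\<lambda>i. p (s i t) (s' i t)) \<longlonglongrightarrow> p (f t) (g t)"
    using s(2) s'(2)
  proof eventually_elim
    case (elim t)
    then have "(\<lambda>i. (s i t, s' i t)) \<longlonglongrightarrow> (f t, g t)"
      by (rule tendsto_Pair)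
    from continuous_on_tendsto_compose[OF p this] show ?case by simp
  qed
  moreover have "simple_function M (\<lambda>t. p (s i t) (s' i t))" for i
    using simple_function_compose2[OF s(1) s'(1), of p i i] by simp
  ultimately show ?thesis
    unfolding strongly_measurable_def by (intro exI[of _ "\<lambda>i t. p (s i t) (s' i t)"]) blast
qed

lemma strongly_measurable_add:
  "strongly_measurable M f \<Longrightarrow> strongly_measurable M g \<Longrightarrow> strongly_measurable M (\<lambda>t. f t + g t)"
  by (rule strongly_measurable_compose2) (auto simp: case_prod_beta intro!: continuous_intros)

lemma strongly_measurable_scaleR:
  "strongly_measurable M a \<Longrightarrow> strongly_measurable M f \<Longrightarrow> strongly_measurable M (\<lambda>t. a t *\<^sub>R f t)"
  by (rule strongly_measurable_compose2) (auto simp: case_prod_beta intro!: continuous_intros)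

lemma strongly_measurable_cong:
  "(\<And>t. t \<in> space M \<Longrightarrow> f t = g t) \<Longrightarrow> strongly_measurable M f \<longleftrightarrow> strongly_measurable M g"
  unfolding strongly_measurable_def by (intro ex_cong1 conj_cong refl AE_cong) simp

lemma has_strong_bochner_integral_cong:
  "(\<And>t. t \<in> space M \<Longrightarrow> f t = g t) \<Longrightarrow>
    has_strong_bochner_integral M f x \<longleftrightarrow> has_strong_bochner_integral M g x"
  unfolding has_strong_bochner_integral_def
  by (intro arg_cong2[where f = "(\<and>)"] ex_cong1 arg_cong2[where f = "(\<and>)"] refl strongly_measurable_cong
      arg_cong[where f = "\<lambda>I. I \<longlonglongrightarrow> 0"] ext nn_integral_cong) simp_all

lemma strong_bochner_integral_cong:
  "(\<And>t. t \<in> space M \<Longrightarrow> f t = g t) \<Longrightarrow> strong_bochner_integral M f = strong_bochner_integral M g"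
  using has_strong_bochner_integral_cong[of M f g]
  unfolding strong_bochner_integral_def by presburger

lemma (in complete_measure) borel_measurable_continuous_strongly_measurable:
  fixes h :: "'b::real_normed_vector \<Rightarrow> 'c::{banach, second_countable_topology}"
  assumes f: "strongly_measurable M f" and h: "continuous_on UNIV h"
  shows "(\<lambda>t. h (f t)) \<in> borel_measurable M"
proof -
  obtain s where s: "\<And>i. simple_function M (s i)" "AE t in M. (\<lambda>i. s i t) \<longlonglongrightarrow> f t"
    using f unfolding strongly_measurable_def by blast
  show ?thesis
  proof (rule borel_measurable_AE_LIMSEQ)
    show "(\<lambda>t. h (s i t)) \<in> borel_measurable M" for i
      using simple_function_compose1[OF s(1), of h i] by (rule borel_measurable_simple_function)
    show "AE t in M. (\<lambda>i. h (s i t)) \<longlonglongrightarrow> h (f t)"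
      using s(2) by eventually_elim (rule continuous_on_tendsto_compose[OF h], auto)
  qed
qed

lemma (in complete_measure) borel_measurable_norm_strongly_measurable:
  "strongly_measurable M f \<Longrightarrow> (\<lambda>t. norm (f t)) \<in> borel_measurable M"
  by (rule borel_measurable_continuous_strongly_measurable) (auto intro!: continuous_intros)

text \<open>
  Cutting the approximating simple functions off where they exceed \<open>2 \<parallel>f\<parallel>\<close> preserves their pointwise
  limit, also where \<open>f\<close> vanishes, and makes dominated convergence applicable.
\<close>

lemma (in complete_measure) has_strong_bochner_integral_exists:
  fixes f :: "'a \<Rightarrow> 'b::banach"
  assumes f: "strongly_measurable M f" and int: "integrable M (\<lambda>t. norm (f t))"
  shows "\<exists>x. has_strong_bochner_integral M f x"
proof -
  note [measurable] = borel_measurable_norm_strongly_measurable[OF f]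
  obtain s where s: "\<And>i. simple_function M (s i)" "AE t in M. (\<lambda>i. s i t) \<longlonglongrightarrow> f t"
    using f unfolding strongly_measurable_def by blast
  define s' where "s' i t = (if norm (s i t) \<le> 2 * norm (f t) then s i t else 0)" for i t
  have [measurable]: "(\<lambda>t. norm (s i t)) \<in> borel_measurable M" for i
    using simple_function_compose1[OF s(1), of norm i] by (rule borel_measurable_simple_function)
  have simple: "simple_function M (s' i)" for i
    unfolding s'_def by (rule simple_function_If[OF s(1)]) auto
  have s'_le: "norm (s' i t) \<le> 2 * norm (f t)" for i t
    by (simp add: s'_def)
  have s'_lim: "AE t in M. (\<lambda>i. s' i t) \<longlonglongrightarrow> f t"
    using s(2)
  proof eventually_elim
    case (elim t)
    show ?case
    proof (cases "f t = 0")
      case True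
      then have "s' i t = 0" for i using s'_le[of i t] by simp
      with True show ?thesis by simp
    next
      case False
      have "\<forall>\<^sub>F i in sequentially. norm (s i t) < 2 * norm (f t)"
        using order_tendstoD(2)[OF tendsto_norm[OF elim]] False by simp
      then have "\<forall>\<^sub>F i in sequentially. s i t = s' i t"
        by eventually_elim (simp add: s'_def)
      with elim show ?thesis by (rule Lim_transform_eventually)
    qed
  qed
  have int2: "(\<integral>\<^sup>+ t. ennreal (2 * norm (f t)) \<partial>M) < \<infinity>"
    using int by (subst nn_integral_eq_integral) auto
  have bochner: "Bochner_Integration.simple_bochner_integrable M (s' i)" for i
  proof (rule simple_bochner_integrableI_bounded[OF simple])
    have "(\<integral>\<^sup>+ t. ennreal (norm (s' i t)) \<partial>M) \<le> (\<integral>\<^sup>+ t. ennreal (2 * norm (f t)) \<partial>M)"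
      by (intro nn_integral_mono ennreal_leI s'_le)
    also note int2
    finally show "(\<integral>\<^sup>+ t. ennreal (norm (s' i t)) \<partial>M) < \<infinity>" .
  qed
  have diff_meas: "(\<lambda>t. norm (f t - s' i t)) \<in> borel_measurable M" for i
    using strongly_measurable_add[OF f strongly_measurable_scaleR[OF strongly_measurable_const[of M "-1"]
        strongly_measurable_simple[OF simple[of i]]]]
    by (intro borel_measurable_norm_strongly_measurable) simp
  have lim0: "(\<lambda>i. \<integral>\<^sup>+ t. ennreal (norm (f t - s' i t)) \<partial>M) \<longlonglongrightarrow> 0"
  proof -
    have "(\<lambda>i. \<integral>\<^sup>+ t. ennreal (norm (f t - s' i t)) \<partial>M) \<longlonglongrightarrow> (\<integral>\<^sup>+ t. 0 \<partial>M)"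
    proof (rule nn_integral_dominated_convergence)
      show "(\<lambda>t. ennreal (norm (f t - s' i t))) \<in> borel_measurable M" for i
        using diff_meas by measurable
      show "AE t in M. ennreal (norm (f t - s' i t)) \<le> ennreal (3 * norm (f t))" for i
      proof (rule AE_I2, rule ennreal_leI)
        fix t show "norm (f t - s' i t) \<le> 3 * norm (f t)"
          using norm_triangle_ineq4[of "f t" "s' i t"] s'_le[of i t] by simp
      qed
      show "(\<integral>\<^sup>+ t. ennreal (3 * norm (f t)) \<partial>M) < \<infinity>"
        using int by (subst nn_integral_eq_integral) auto
      show "AE t in M. (\<lambda>i. ennreal (norm (f t - s' i t))) \<longlonglongrightarrow> 0"
        using s'_lim
      proof eventually_elim
        case (elim t)
        have "(\<lambda>i. norm (f t - s' i t)) \<longlonglongrightarrow> norm (f t - f t)"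
          using elim by (intro tendsto_intros)
        from tendsto_ennrealI[OF this] show ?case by simp
      qed
    qed auto
    then show ?thesis by simp
  qed
  define I where "I i = Bochner_Integration.simple_bochner_integral M (s' i)" for i
  have I_diff: "ennreal (norm (I i - I j)) \<le>
      (\<integral>\<^sup>+ t. ennreal (norm (f t - s' i t)) \<partial>M) + (\<integral>\<^sup>+ t. ennreal (norm (f t - s' j t)) \<partial>M)" for i j
  proof -
    have "ennreal (norm (I i - I j)) = norm (Bochner_Integration.simple_bochner_integral M (\<lambda>t. s' i t - s' j t))"
      by (simp add: I_def simple_bochner_integral_diff bochner)
    also have "\<dots> \<le> Bochner_Integration.simple_bochner_integral M (\<lambda>t. norm (s' i t - s' j t))"
      using simple_bochner_integrable_compose2[of "(-)" M "s' i" "s' j"] bochner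
      by (intro ennreal_leI simple_bochner_integral_norm_bound) simp
    also have "\<dots> = (\<integral>\<^sup>+ t. norm (s' i t - s' j t) \<partial>M)"
      using simple_bochner_integrable_compose2[of "\<lambda>x y. norm (x - y)" M "s' i" "s' j"] bochner
      by (intro simple_bochner_integral_eq_nn_integral) auto
    also have "\<dots> \<le> (\<integral>\<^sup>+ t. ennreal (norm (f t - s' i t)) + ennreal (norm (f t - s' j t)) \<partial>M)"
    proof (rule nn_integral_mono)
      fix t
      have "norm (s' i t - s' j t) \<le> norm (f t - s' i t) + norm (f t - s' j t)"
        using norm_triangle_ineq4[of "f t - s' j t" "f t - s' i t"] by simp
      then show "ennreal (norm (s' i t - s' j t)) \<le> ennreal (norm (f t - s' i t)) + ennreal (norm (f t - s' j t))"
        by (simp flip: ennreal_plus)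
    qed
    also have "\<dots> = (\<integral>\<^sup>+ t. ennreal (norm (f t - s' i t)) \<partial>M) + (\<integral>\<^sup>+ t. ennreal (norm (f t - s' j t)) \<partial>M)"
      using diff_meas by (intro nn_integral_add) auto
    finally show ?thesis .
  qed
  have "Cauchy I"
  proof (rule metric_CauchyI)
    fix e :: real assume "e > 0"
    then have "\<forall>\<^sub>F i in sequentially. (\<integral>\<^sup>+ t. ennreal (norm (f t - s' i t)) \<partial>M) < ennreal (e / 2)"
      by (intro order_tendstoD(2)[OF lim0]) simp
    then obtain N where N: "\<And>i. i \<ge> N \<Longrightarrow> (\<integral>\<^sup>+ t. ennreal (norm (f t - s' i t)) \<partial>M) < ennreal (e / 2)"
      by (auto simp: eventually_sequentially)
    have "dist (I i) (I j) < e" if "i \<ge> N" "j \<ge> N" for i j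
    proof -
      have "ennreal (norm (I i - I j)) < ennreal (e / 2) + ennreal (e / 2)"
        using I_diff[of i j] add_strict_mono[OF N[OF that(1)] N[OF that(2)]] by (rule le_less_trans)
      also have "\<dots> = ennreal e"
        using \<open>e > 0\<close> by (simp flip: ennreal_plus)
      finally show ?thesis
        using \<open>e > 0\<close> by (simp add: dist_norm ennreal_less_iff)
    qed
    then show "\<exists>N. \<forall>i\<ge>N. \<forall>j\<ge>N. dist (I i) (I j) < e" by blast
  qed
  then obtain x where "I \<longlonglongrightarrow> x"
    using Cauchy_convergent convergent_def by blast
  then show ?thesis
    unfolding has_strong_bochner_integral_def I_def using f bochner lim0 by blast
qed

lemma (in complete_measure) has_bochner_integral_functional:
  fixes f :: "'a \<Rightarrow> 'b::real_normed_vector" and \<phi> :: "'b \<Rightarrow>\<^sub>L real"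
  assumes "has_strong_bochner_integral M f x"
  shows "has_bochner_integral M (\<lambda>t. blinfun_apply \<phi> (f t)) (blinfun_apply \<phi> x)"
proof -
  obtain s where f: "strongly_measurable M f"
    and s: "\<And>i. Bochner_Integration.simple_bochner_integrable M (s i)"
    and lim0: "(\<lambda>i. \<integral>\<^sup>+ t. ennreal (norm (f t - s i t)) \<partial>M) \<longlonglongrightarrow> 0"
    and limx: "(\<lambda>i. Bochner_Integration.simple_bochner_integral M (s i)) \<longlonglongrightarrow> x"
    using assms unfolding has_strong_bochner_integral_def by blast
  have lin: "linear (blinfun_apply \<phi>)"
    by (simp add: bounded_linear.linear blinfun.bounded_linear_right)
  show ?thesis
  proof (rule has_bochner_integral.intros[where s = "\<lambda>i t. blinfun_apply \<phi> (s i t)"])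
    show "(\<lambda>t. blinfun_apply \<phi> (f t)) \<in> borel_measurable M"
      using f by (rule borel_measurable_continuous_strongly_measurable) (intro continuous_intros)
    show "Bochner_Integration.simple_bochner_integrable M (\<lambda>t. blinfun_apply \<phi> (s i t))" for i
      using simple_bochner_integrable_compose2[of "\<lambda>x y. blinfun_apply \<phi> x" M "s i" "s i"] s by simp
    show "(\<lambda>i. Bochner_Integration.simple_bochner_integral M (\<lambda>t. blinfun_apply \<phi> (s i t))) \<longlonglongrightarrow> blinfun_apply \<phi> x"
      unfolding simple_bochner_integral_linear[OF lin s] by (intro tendsto_intros limx)
    show "(\<lambda>i. \<integral>\<^sup>+ t. ennreal (norm (blinfun_apply \<phi> (f t) - blinfun_apply \<phi> (s i t))) \<partial>M) \<longlonglongrightarrow> 0"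
    proof (rule tendsto_sandwich[OF _ _ tendsto_const])
      show "\<forall>\<^sub>F i in sequentially. (\<integral>\<^sup>+ t. ennreal (norm (blinfun_apply \<phi> (f t) - blinfun_apply \<phi> (s i t))) \<partial>M)
          \<le> ennreal (norm \<phi>) * (\<integral>\<^sup>+ t. ennreal (norm (f t - s i t)) \<partial>M)"
      proof (rule always_eventually, rule allI)
        fix i
        have "(\<lambda>t. norm (f t - s i t)) \<in> borel_measurable M"
          using strongly_measurable_add[OF f strongly_measurable_scaleR[OF strongly_measurable_const[of M "-1"]
              strongly_measurable_simple, of "s i"]] s[of i]
          by (intro borel_measurable_norm_strongly_measurable) (auto elim: simple_bochner_integrable.cases)
        then have "ennreal (norm \<phi>) * (\<integral>\<^sup>+ t. ennreal (norm (f t - s i t)) \<partial>M)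
            = (\<integral>\<^sup>+ t. ennreal (norm \<phi>) * ennreal (norm (f t - s i t)) \<partial>M)"
          by (intro nn_integral_cmult[symmetric]) auto
        moreover have "ennreal (norm (blinfun_apply \<phi> (f t) - blinfun_apply \<phi> (s i t)))
            \<le> ennreal (norm \<phi>) * ennreal (norm (f t - s i t))" for t
          using norm_blinfun[of \<phi> "f t - s i t"]
          by (simp add: blinfun.diff_right flip: ennreal_mult)
        ultimately show "(\<integral>\<^sup>+ t. ennreal (norm (blinfun_apply \<phi> (f t) - blinfun_apply \<phi> (s i t))) \<partial>M)
          \<le> ennreal (norm \<phi>) * (\<integral>\<^sup>+ t. ennreal (norm (f t - s i t)) \<partial>M)"
          by (simp add: nn_integral_mono)
      qed
      show "(\<lambda>i. ennreal (norm \<phi>) * (\<integral>\<^sup>+ t. ennreal (norm (f t - s i t)) \<partial>M)) \<longlonglongrightarrow> 0"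
        using ennreal_tendsto_cmult[OF _ lim0, of "ennreal (norm \<phi>)"] by simp
    qed simp
  qed
qed

lemma functionals_separate_points:
  fixes x y :: "'a::real_normed_vector"
  assumes "\<And>\<phi> :: 'a \<Rightarrow>\<^sub>L real. blinfun_apply \<phi> x = blinfun_apply \<phi> y"
  shows "x = y"
proof -
  obtain \<phi> :: "'a \<Rightarrow>\<^sub>L real" where "norm (x - y) \<le> blinfun_apply \<phi> (x - y)"
    using separate_convex_from_ball[of "{x - y}" "norm (x - y)"] by auto
  then show ?thesis using assms[of \<phi>] by (simp add: blinfun.diff_right)
qed

text \<open>
  Bounded functionals separate points, so the strong Bochner integral inherits uniqueness and linearity from
  the scalar integral.
\<close>

lemma (in complete_measure) strong_bochner_integral_functional:
  fixes f :: "'a \<Rightarrow> 'b::banach" and \<phi> :: "'b \<Rightarrow>\<^sub>L real"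
  assumes f: "strongly_measurable M f" and int: "integrable M (\<lambda>t. norm (f t))"
  shows "integrable M (\<lambda>t. blinfun_apply \<phi> (f t))"
    and "blinfun_apply \<phi> (strong_bochner_integral M f) = (\<integral>t. blinfun_apply \<phi> (f t) \<partial>M)"
proof -
  obtain x where x: "has_strong_bochner_integral M f x"
    using has_strong_bochner_integral_exists[OF f int] by blast
  have "y = x" if "has_strong_bochner_integral M f y" for y
  proof (rule functionals_separate_points)
    fix \<psi> :: "'b \<Rightarrow>\<^sub>L real"
    show "blinfun_apply \<psi> y = blinfun_apply \<psi> x"
      using has_bochner_integral_functional[OF that, of \<psi>] has_bochner_integral_functional[OF x, of \<psi>]
      by (rule has_bochner_integral_eq)
  qed
  with x have "(THE x. has_strong_bochner_integral M f x) = x"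
    by (rule the_equality)
  with x have eq: "strong_bochner_integral M f = x"
    unfolding strong_bochner_integral_def by (subst if_P) blast+
  show "integrable M (\<lambda>t. blinfun_apply \<phi> (f t))"
    and "blinfun_apply \<phi> (strong_bochner_integral M f) = (\<integral>t. blinfun_apply \<phi> (f t) \<partial>M)"
    using has_bochner_integral_functional[OF x, of \<phi>]
    by (auto simp: eq has_bochner_integral_iff)
qed

lemma complete_measure_lebesgue_on:
  assumes "A \<in> sets lebesgue"
  shows "complete_measure (lebesgue_on A)"
proof
  fix N' N assume sub: "N' \<subseteq> N" and N: "N \<in> null_sets (lebesgue_on A)"
  then have "N \<in> null_sets lebesgue" and "N \<subseteq> A"
    using assms by (auto simp: null_sets_restrict_space)
  then have "N' \<in> null_sets lebesgue"
    using sub completion.complete2 by blast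
  then show "N' \<in> sets (lebesgue_on A)"
    using sub \<open>N \<subseteq> A\<close> unfolding sets_restrict_space
    by (intro image_eqI[of _ _ N']) auto
qed

section \<open>Balls in Bochner-Lebesgue spaces\<close>

text \<open>
  At the boundary point 0 the convexity of the power function amounts to \<open>c ^ p \<le> c\<close> for \<open>0 \<le> c \<le> 1\<close>.
\<close>

lemma powr_convex_combination:
  fixes x y a b p :: real
  assumes "1 \<le> p" "0 \<le> x" "0 \<le> y" "0 \<le> a" "0 \<le> b" "a + b = 1"
  shows "(a * x + b * y) powr p \<le> a * x powr p + b * y powr p"
proof -
  have shrink: "(c * z) powr p \<le> c * z powr p" if "0 \<le> c" "c \<le> 1" "0 \<le> z" for c z :: real
  proof -
    have "c powr p \<le> c"
      using powr_mono'[of 1 p c] that \<open>1 \<le> p\<close> by simp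
    then show ?thesis by (simp add: powr_mult mult_right_mono)
  qed
  consider "x = 0" | "y = 0" | "0 < x" "0 < y" using assms by linarith
  then show ?thesis
  proof cases
    case 3
    have a: "a = 1 - b" using assms by simp
    from 3 show ?thesis
      using convex_onD[OF powr_convex[OF \<open>1 \<le> p\<close>], of b x y] assms
      by (simp add: a)
  qed (use shrink[of a x] shrink[of b y] assms in auto)
qed

lemma integrable_nonneg_dominated:
  fixes f g :: "'a \<Rightarrow> real"
  assumes "integrable M g" and "f \<in> borel_measurable M" and "\<And>t. 0 \<le> f t" and "\<And>t. f t \<le> g t"
  shows "integrable M f"
proof (rule Bochner_Integration.integrable_bound[OF assms(1,2)], rule AE_I2)
  show "norm (f t) \<le> norm (g t)" for t
    using assms(3,4)[of t] by simp
qed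

theorem Hoelder_inequality:
  fixes f g :: "'a \<Rightarrow> real"
  assumes pq: "p > 1" "q > 1" "1 / p + 1 / q = 1"
    and f [measurable]: "f \<in> borel_measurable M" and g [measurable]: "g \<in> borel_measurable M"
    and f0: "\<And>t. 0 \<le> f t" and g0: "\<And>t. 0 \<le> g t"
    and fp: "integrable M (\<lambda>t. f t powr p)" and gq: "integrable M (\<lambda>t. g t powr q)"
  shows "(\<integral>t. f t * g t \<partial>M) \<le> (\<integral>t. f t powr p \<partial>M) powr (1 / p) * (\<integral>t. g t powr q \<partial>M) powr (1 / q)"
proof -
  define A where "A = (\<integral>t. f t powr p \<partial>M)"
  define B where "B = (\<integral>t. g t powr q \<partial>M)"
  have "A \<ge> 0" "B \<ge> 0" by (simp_all add: A_def B_def)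
  show ?thesis
  proof (cases "A = 0 \<or> B = 0")
    case True
    then have "AE t in M. f t * g t = 0"
    proof
      assume "A = 0"
      then have "AE t in M. f t powr p = 0"
        using integral_nonneg_eq_0_iff_AE[OF fp] by (simp add: A_def)
      then show ?thesis by eventually_elim simp
    next
      assume "B = 0"
      then have "AE t in M. g t powr q = 0"
        using integral_nonneg_eq_0_iff_AE[OF gq] by (simp add: B_def)
      then show ?thesis by eventually_elim simp
    qed
    then have "(\<integral>t. f t * g t \<partial>M) = 0"
      using integral_cong_AE[of "\<lambda>t. f t * g t" M "\<lambda>_. 0"] by simp
    then show ?thesis by simp
  next
    case False
    define a where "a = A powr (1 / p)"
    define b where "b = B powr (1 / q)"
    have ab: "a > 0" "b > 0" "a powr p = A" "b powr q = B"
      using False \<open>A \<ge> 0\<close> \<open>B \<ge> 0\<close> pq by (simp_all add: a_def b_def powr_powr)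
    have young: "f t * g t \<le> a * b * (f t powr p / (A * p) + g t powr q / (B * q))" for t
      using Youngs_inequality[OF pq, of "f t / a" "g t / b"] ab f0[of t] g0[of t]
      by (simp add: powr_divide field_simps)
    have dom: "integrable M (\<lambda>t. a * b * (f t powr p / (A * p) + g t powr q / (B * q)))"
      using fp gq by (intro integrable_mult_right Bochner_Integration.integrable_add integrable_divide) auto
    have "integrable M (\<lambda>t. f t * g t)"
      using young f0 g0 by (intro integrable_nonneg_dominated[OF dom]) simp_all
    then have "(\<integral>t. f t * g t \<partial>M) \<le> (\<integral>t. a * b * (f t powr p / (A * p) + g t powr q / (B * q)) \<partial>M)"
      using dom young by (intro integral_mono)
    also have "\<dots> = a * b * (A / (A * p) + B / (B * q))"
      using fp gq by (simp add: A_def B_def)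
    also have "\<dots> = a * b"
      using False pq(3) by simp
    finally show ?thesis by (simp add: a_def b_def A_def B_def)
  qed
qed

definition Lp_ball :: "ennreal \<Rightarrow> 'a measure \<Rightarrow> real \<Rightarrow> ('a \<Rightarrow> 'b::real_normed_vector) set"
  where "Lp_ball r M R = {u \<in> Lp_space r M. Lp_norm r M u \<le> R}"

text \<open>
  Bounding the integral of the \<open>p\<close>-th power instead of its root reduces convexity of the ball to convexity
  of the power function.
\<close>

lemma (in complete_measure) Lp_ball_finite_iff:
  assumes "1 \<le> p" and "0 \<le> R"
  shows "u \<in> Lp_ball (ennreal p) M R \<longleftrightarrow> strongly_measurable M u \<and>
    integrable M (\<lambda>t. norm (u t) powr p) \<and> (\<integral>t. norm (u t) powr p \<partial>M) \<le> R powr p"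
proof -
  have "I powr (1 / p) \<le> R \<longleftrightarrow> I \<le> R powr p" if "0 \<le> I" for I
    using powr_mono2[of p "I powr (1 / p)" R] powr_mono2[of "1 / p" I "R powr p"] assms that
    by (auto simp: powr_powr)
  from this[of "\<integral>t. norm (u t) powr p \<partial>M"] show ?thesis
    using assms by (auto simp: Lp_ball_def Lp_space_def Lp_norm_def)
qed

lemma (in complete_measure) Lp_ball_top_iff:
  assumes "0 \<le> R"
  shows "u \<in> Lp_ball top M R \<longleftrightarrow> strongly_measurable M u \<and> (AE t in M. norm (u t) \<le> R)"
proof (intro iffI conjI; (elim conjE)?)
  assume u: "u \<in> Lp_ball top M R"
  then show "strongly_measurable M u" by (simp add: Lp_ball_def Lp_space_def)
  have "esssup M (\<lambda>t. ennreal (norm (u t))) \<le> ennreal R"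
    using u assms
    by (cases "esssup M (\<lambda>t. ennreal (norm (u t)))") (auto simp: Lp_ball_def Lp_space_def Lp_norm_def)
  then show "AE t in M. norm (u t) \<le> R"
    using esssup_AE[of "\<lambda>t. ennreal (norm (u t))" M] assms
    by (auto elim!: eventually_mono dest: order_trans)
next
  assume u: "strongly_measurable M u" and le: "AE t in M. norm (u t) \<le> R"
  have [measurable]: "(\<lambda>t. norm (u t)) \<in> borel_measurable M"
    using u by (rule borel_measurable_norm_strongly_measurable)
  have "esssup M (\<lambda>t. ennreal (norm (u t))) \<le> ennreal R"
    using le by (intro esssup_I) (auto elim!: eventually_mono intro: ennreal_leI)
  then show "u \<in> Lp_ball top M R"
    using u assms le_less_trans[OF _ ennreal_less_top]
    by (auto simp: Lp_ball_def Lp_space_def Lp_norm_def enn2real_leI)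
qed

lemma one_le_ennreal_cases [consumes 1, case_names top finite]:
  assumes "1 \<le> (r::ennreal)"
  obtains "r = top" | p where "1 \<le> p" "r = ennreal p"
  using assms by (cases r) auto

lemma Lp_ball_strongly_measurable: "u \<in> Lp_ball r M R \<Longrightarrow> strongly_measurable M u"
  by (simp add: Lp_ball_def Lp_space_def)

lemma (in complete_measure) Lp_ball_integrable_norm:
  assumes "finite_measure M" and "1 \<le> r" and "0 \<le> R" and u: "u \<in> Lp_ball r M R"
  shows "integrable M (\<lambda>t. norm (u t))"
proof -
  interpret finite_measure M by fact
  have meas: "(\<lambda>t. norm (u t)) \<in> borel_measurable M"
    using Lp_ball_strongly_measurable[OF u] by (rule borel_measurable_norm_strongly_measurable)
  show ?thesis
    using \<open>1 \<le> r\<close>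
  proof (cases rule: one_le_ennreal_cases)
    case top
    then have "AE t in M. norm (norm (u t)) \<le> R"
      using u \<open>0 \<le> R\<close> by (simp add: Lp_ball_top_iff)
    then show ?thesis
      using meas by (rule integrable_const_bound)
  next
    case (finite p)
    have "integrable M (\<lambda>t. 1 + norm (u t) powr p)"
      using u finite \<open>0 \<le> R\<close> by (simp add: Lp_ball_finite_iff)
    moreover have "norm (u t) \<le> 1 + norm (u t) powr p" for t
    proof (cases "norm (u t) \<le> 1")
      case False
      then show ?thesis using powr_mono[of 1 p "norm (u t)"] finite(1) by simp
    qed (simp add: add_increasing2)
    ultimately show ?thesis
      by (rule integrable_nonneg_dominated[OF _ meas norm_ge_zero])
  qed
qed

lemma (in complete_measure) Lp_ball_convex:
  fixes u v :: "'a \<Rightarrow> 'b::real_normed_vector"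
  assumes "1 \<le> r" and "0 \<le> R" and u: "u \<in> Lp_ball r M R" and v: "v \<in> Lp_ball r M R"
    and ab: "0 \<le> a" "0 \<le> b" "a + b = 1"
  shows "(\<lambda>t. a *\<^sub>R u t + b *\<^sub>R v t) \<in> Lp_ball r M R"
proof -
  let ?w = "\<lambda>t. a *\<^sub>R u t + b *\<^sub>R v t"
  have meas: "strongly_measurable M ?w"
    using Lp_ball_strongly_measurable[OF u] Lp_ball_strongly_measurable[OF v]
    by (intro strongly_measurable_add strongly_measurable_scaleR strongly_measurable_const)
  have [measurable]: "(\<lambda>t. norm (?w t)) \<in> borel_measurable M"
    using meas by (rule borel_measurable_norm_strongly_measurable)
  have norm_le: "norm (?w t) \<le> a * norm (u t) + b * norm (v t)" for t
    using norm_triangle_ineq[of "a *\<^sub>R u t" "b *\<^sub>R v t"] ab by simp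
  show ?thesis
    using \<open>1 \<le> r\<close>
  proof (cases rule: one_le_ennreal_cases)
    case top
    have "AE t in M. norm (u t) \<le> R" "AE t in M. norm (v t) \<le> R"
      using u v \<open>0 \<le> R\<close> unfolding top by (simp_all add: Lp_ball_top_iff)
    then have "AE t in M. norm (?w t) \<le> R"
    proof eventually_elim
      case (elim t)
      note norm_le[of t]
      also have "a * norm (u t) + b * norm (v t) \<le> R"
        using elim ab by (rule convex_bound_le)
      finally show ?case .
    qed
    with meas top \<open>0 \<le> R\<close> show ?thesis by (simp add: Lp_ball_top_iff)
  next
    case (finite p)
    have up: "integrable M (\<lambda>t. norm (u t) powr p)" "(\<integral>t. norm (u t) powr p \<partial>M) \<le> R powr p"
      and vp: "integrable M (\<lambda>t. norm (v t) powr p)" "(\<integral>t. norm (v t) powr p \<partial>M) \<le> R powr p"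
      using u v finite \<open>0 \<le> R\<close> by (simp_all add: Lp_ball_finite_iff)
    have wp_le: "norm (?w t) powr p \<le> a * norm (u t) powr p + b * norm (v t) powr p" for t
    proof -
      have "norm (?w t) powr p \<le> (a * norm (u t) + b * norm (v t)) powr p"
        using norm_le finite(1) by (intro powr_mono2) auto
      also have "\<dots> \<le> a * norm (u t) powr p + b * norm (v t) powr p"
        using finite(1) ab by (intro powr_convex_combination) auto
      finally show ?thesis .
    qed
    have dom: "integrable M (\<lambda>t. a * norm (u t) powr p + b * norm (v t) powr p)"
      using up vp by simp
    have wp: "integrable M (\<lambda>t. norm (?w t) powr p)"
      using wp_le by (intro integrable_nonneg_dominated[OF dom]) simp_all
    have "(\<integral>t. norm (?w t) powr p \<partial>M) \<le> (\<integral>t. a * norm (u t) powr p + b * norm (v t) powr p \<partial>M)"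
      using wp dom wp_le by (rule integral_mono)
    also have "\<dots> = a * (\<integral>t. norm (u t) powr p \<partial>M) + b * (\<integral>t. norm (v t) powr p \<partial>M)"
      using up vp by simp
    also have "\<dots> \<le> R powr p"
      using up(2) vp(2) ab by (rule convex_bound_le)
    finally show ?thesis
      using meas wp finite \<open>0 \<le> R\<close> by (simp add: Lp_ball_finite_iff)
  qed
qed

lemma conjugate_exponents_cases [consumes 3, case_names top_one one_top finite]:
  assumes "1 \<le> (r::ennreal)" and "1 \<le> r'" and "1 / r + 1 / r' = 1"
  obtains "r = top" "r' = 1" | "r = 1" "r' = top"
  | p q where "r = ennreal p" "r' = ennreal q" "p > 1" "q > 1" "1 / p + 1 / q = 1"
proof -
  have inv_one: "x = 1" if "1 \<le> x" "1 / x = 1" for x :: ennreal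
    using that by (metis one_divide_one_divide_ennreal divide_ennreal_def ennreal_inverse_1 mult_1)
  show thesis
    using \<open>1 \<le> r\<close>
  proof (cases rule: one_le_ennreal_cases)
    case top
    then show thesis using that(1) inv_one assms by simp
  next
    case (finite p)
    show thesis
      using \<open>1 \<le> r'\<close>
    proof (cases rule: one_le_ennreal_cases)
      case top
      then show thesis using that(2) inv_one assms by simp
    next
      case (finite q)
      have "1 / r = ennreal (1 / p)" "1 / r' = ennreal (1 / q)"
        using \<open>1 \<le> p\<close> \<open>1 \<le> q\<close> divide_ennreal[of 1 p] divide_ennreal[of 1 q]
        by (simp_all add: \<open>r = ennreal p\<close> \<open>r' = ennreal q\<close>)
      then have "ennreal (1 / p + 1 / q) = ennreal 1"
        using assms(3) \<open>1 \<le> p\<close> \<open>1 \<le> q\<close> by (simp add: ennreal_plus)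
      then have sum: "1 / p + 1 / q = 1"
        using \<open>1 \<le> p\<close> \<open>1 \<le> q\<close> by (subst (asm) ennreal_inj) auto
      moreover have "1 / p > 0" "1 / q > 0"
        using \<open>1 \<le> p\<close> \<open>1 \<le> q\<close> by simp_all
      ultimately have "1 / p < 1" "1 / q < 1" by linarith+
      then have "p > 1" "q > 1"
        using \<open>1 \<le> p\<close> \<open>1 \<le> q\<close> by (simp_all add: divide_less_eq)
      with sum show thesis
        using that(3) \<open>r = ennreal p\<close> \<open>r' = ennreal q\<close> by blast
    qed
  qed
qed

section \<open>Controls driving a strongly continuous family of operators\<close>

text \<open>
  For each rational \<open>c\<close> the open sets \<open>{t. c < \<phi> w t}\<close> have a countable subfamily with the same union, by the
  Lindeloef property.  Collecting the indices over all \<open>c\<close> gives the sequence.  It does not depend on \<open>t\<close>, which is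
  what makes a measurable selection possible even if the index set \<open>V\<close> is uncountable.
\<close>

lemma countable_sup_subfamily:
  fixes \<phi> :: "'v \<Rightarrow> 'a::second_countable_topology \<Rightarrow> real"
  assumes "V \<noteq> {}" and cont: "\<And>v. v \<in> V \<Longrightarrow> continuous_on UNIV (\<phi> v)"
  obtains v :: "nat \<Rightarrow> 'v" where "range v \<subseteq> V"
    and "\<And>w t m. w \<in> V \<Longrightarrow> m < \<phi> w t \<Longrightarrow> \<exists>n. m < \<phi> (v n) t"
proof -
  have "\<exists>W. W \<subseteq> V \<and> countable W \<and> (\<Union>w\<in>W. {t. c < \<phi> w t}) = (\<Union>w\<in>V. {t. c < \<phi> w t})" for c
  proof -
    have op: "open S" if "S \<in> (\<lambda>w. {t. c < \<phi> w t}) ` V" for S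
      using that cont by (auto intro!: open_Collect_less continuous_intros)
    obtain \<F> where "\<F> \<subseteq> (\<lambda>w. {t. c < \<phi> w t}) ` V" "countable \<F>"
      and eq: "\<Union>\<F> = (\<Union>w\<in>V. {t. c < \<phi> w t})"
      using Lindelof[OF op] by metis
    then obtain W where "countable W" "W \<subseteq> V" "\<F> = (\<lambda>w. {t. c < \<phi> w t}) ` W"
      using countable_subset_image by metis
    with eq show ?thesis by auto
  qed
  then obtain W where W: "\<And>c. W c \<subseteq> V" "\<And>c. countable (W c)"
    "\<And>c. (\<Union>w\<in>W c. {t. c < \<phi> w t}) = (\<Union>w\<in>V. {t. c < \<phi> w t})"
    by metis
  obtain v0 where "v0 \<in> V" using \<open>V \<noteq> {}\<close> by blast
  define W' where "W' = insert v0 (\<Union>c\<in>\<rat>. W c)"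
  have W': "W' \<noteq> {}" "countable W'" "W' \<subseteq> V"
    using W(1,2) \<open>v0 \<in> V\<close> by (auto simp: W'_def countable_rat)
  show thesis
  proof (rule that[of "from_nat_into W'"])
    show "range (from_nat_into W') \<subseteq> V"
      using W' by simp
    fix w t m assume "w \<in> V" "m < \<phi> w t"
    obtain c where c: "c \<in> \<rat>" "m < c" "c < \<phi> w t"
      using Rats_dense_in_real[OF \<open>m < \<phi> w t\<close>] by blast
    then have "t \<in> (\<Union>w\<in>W c. {t. c < \<phi> w t})"
      using W(3)[of c] \<open>w \<in> V\<close> by blast
    then obtain w' where "w' \<in> W'" "c < \<phi> w' t"
      using c(1) by (auto simp: W'_def)
    moreover obtain n where "from_nat_into W' n = w'"
      using from_nat_into_surj[OF W'(2) \<open>w' \<in> W'\<close>] by blast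
    ultimately show "\<exists>n. m < \<phi> (from_nat_into W' n) t"
      using c(2) by (intro exI[of _ n]) simp
  qed
qed

lemma borel_measurable_lebesgue_on: "f \<in> borel_measurable borel \<Longrightarrow> f \<in> borel_measurable (lebesgue_on A)"
  by (intro measurable_restrict_space1 measurable_completion) simp

text \<open>
  In the application \<open>F t = S (T - t) B\<close> for \<open>t\<close> between 0 and \<open>T\<close>, extended to the real line by its values at
  the endpoints, and \<open>L\<close> below is the controllability map.
\<close>

locale control_operators =
  fixes F :: "real \<Rightarrow> ('u::banach \<Rightarrow>\<^sub>L 'x::banach)" and T K :: real
  assumes T_pos: "0 < T"
    and strongly_continuous: "\<And>v. continuous_on UNIV (\<lambda>t. blinfun_apply (F t) v)"
    and norm_le: "\<And>t. norm (F t) \<le> K"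
begin

abbreviation M :: "real measure" where "M \<equiv> lebesgue_on {0<..<T}"

definition L :: "(real \<Rightarrow> 'u) \<Rightarrow> 'x"
  where "L u = strong_bochner_integral M (\<lambda>t. blinfun_apply (F t) (u t))"

text \<open>
  For \<open>q = \<infinity>\<close> the supremum is taken over the closed interval and not up to null sets; for the lower
  semicontinuous functions \<open>g\<close> of interest the two agree.
\<close>

definition dual_size :: "ennreal \<Rightarrow> (real \<Rightarrow> real) \<Rightarrow> real"
  where "dual_size q g = (if q = \<infinity> then SUP t\<in>{0..T}. g t
    else (\<integral>t. g t powr enn2real q \<partial>M) powr (1 / enn2real q))"

sublocale M: complete_measure M
  by (rule complete_measure_lebesgue_on) simp

sublocale M: finite_measure M
proof
  have "emeasure lebesgue {0<..<T} = ennreal T"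
    using T_pos by simp
  then show "emeasure M (space M) \<noteq> \<infinity>"
    by (simp add: emeasure_restrict_space)
qed

lemma K_nonneg: "0 \<le> K"
  using norm_le[of 0] norm_ge_zero order_trans by blast

lemma apply_norm_le: "norm (blinfun_apply (F t) v) \<le> K * norm v"
  using norm_blinfun[of "F t" v] mult_right_mono[OF norm_le norm_ge_zero] by (rule order_trans)

text \<open>
  Joint continuity follows from \<open>F t v = F t (v - w) + F t w\<close>: the first term is small uniformly in \<open>t\<close>, the
  second converges by strong continuity.
\<close>

lemma jointly_continuous: "continuous_on UNIV (\<lambda>(t, v). blinfun_apply (F t) v)"
  unfolding continuous_on_def
proof (intro ballI)
  fix z :: "real \<times> 'u"
  obtain s w where z: "z = (s, w)" by fastforce
  have fst: "((\<lambda>z. fst z) \<longlongrightarrow> s) (at z)" and snd: "((\<lambda>z. snd z) \<longlongrightarrow> w) (at z)"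
    using tendsto_fst[OF tendsto_ident_at, of z UNIV] tendsto_snd[OF tendsto_ident_at, of z UNIV] z by simp_all
  have "((\<lambda>z. blinfun_apply (F (fst z)) (snd z - w)) \<longlongrightarrow> 0) (at z)"
  proof (rule Lim_null_comparison)
    show "\<forall>\<^sub>F z in at z. norm (blinfun_apply (F (fst z)) (snd z - w)) \<le> K * norm (snd z - w)"
      by (simp add: apply_norm_le)
    have "((\<lambda>z. K * norm (snd z - w)) \<longlongrightarrow> K * norm (w - w)) (at z)"
      by (intro tendsto_intros snd)
    then show "((\<lambda>z. K * norm (snd z - w)) \<longlongrightarrow> 0) (at z)" by simp
  qed
  moreover have "((\<lambda>z. blinfun_apply (F (fst z)) w) \<longlongrightarrow> blinfun_apply (F s) w) (at z)"
    by (rule continuous_on_tendsto_compose[OF strongly_continuous fst]) simp_all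
  ultimately have "((\<lambda>z. blinfun_apply (F (fst z)) (snd z - w) + blinfun_apply (F (fst z)) w) \<longlongrightarrow>
      0 + blinfun_apply (F s) w) (at z)"
    by (rule tendsto_add)
  then show "((\<lambda>(t, v). blinfun_apply (F t) v) \<longlongrightarrow> (case z of (t, v) \<Rightarrow> blinfun_apply (F t) v)) (at z within UNIV)"
    by (simp add: z case_prod_unfold flip: blinfun.add_right)
qed

lemma strongly_measurable_apply:
  assumes "strongly_measurable M u"
  shows "strongly_measurable M (\<lambda>t. blinfun_apply (F t) (u t))"
  using strongly_measurable_compose2[OF strongly_measurable_borel[OF borel_measurable_lebesgue_on[of "\<lambda>t. t"]]
      assms jointly_continuous]
  by simp

lemma functional_L:
  fixes f :: "'x \<Rightarrow>\<^sub>L real"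
  assumes u: "strongly_measurable M u" and int: "integrable M (\<lambda>t. norm (u t))"
  shows "integrable M (\<lambda>t. blinfun_apply f (blinfun_apply (F t) (u t)))"
    and "blinfun_apply f (L u) = (\<integral>t. blinfun_apply f (blinfun_apply (F t) (u t)) \<partial>M)"
proof -
  note meas = strongly_measurable_apply[OF u]
  have "integrable M (\<lambda>t. K * norm (u t))"
    using int by simp
  then have "integrable M (\<lambda>t. norm (blinfun_apply (F t) (u t)))"
    by (rule integrable_nonneg_dominated[OF _ M.borel_measurable_norm_strongly_measurable[OF meas] norm_ge_zero apply_norm_le])
  from M.strong_bochner_integral_functional[OF meas this, of f]
  show "integrable M (\<lambda>t. blinfun_apply f (blinfun_apply (F t) (u t)))"
    and "blinfun_apply f (L u) = (\<integral>t. blinfun_apply f (blinfun_apply (F t) (u t)) \<partial>M)"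
    by (simp_all add: L_def)
qed

lemma L_linear:
  assumes "strongly_measurable M u" "integrable M (\<lambda>t. norm (u t))"
    and "strongly_measurable M v" "integrable M (\<lambda>t. norm (v t))"
    and "integrable M (\<lambda>t. norm (a *\<^sub>R u t + b *\<^sub>R v t))"
  shows "L (\<lambda>t. a *\<^sub>R u t + b *\<^sub>R v t) = a *\<^sub>R L u + b *\<^sub>R L v"
proof (rule functionals_separate_points)
  fix f :: "'x \<Rightarrow>\<^sub>L real"
  have meas: "strongly_measurable M (\<lambda>t. a *\<^sub>R u t + b *\<^sub>R v t)"
    using assms by (intro strongly_measurable_add strongly_measurable_scaleR strongly_measurable_const)
  show "blinfun_apply f (L (\<lambda>t. a *\<^sub>R u t + b *\<^sub>R v t)) = blinfun_apply f (a *\<^sub>R L u + b *\<^sub>R L v)"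
    using functional_L[OF assms(1,2), of f] functional_L[OF assms(3,4), of f] functional_L(2)[OF meas assms(5), of f]
    by (simp add: blinfun.add_right blinfun.scaleR_right)
qed

lemma convex_reachable:
  assumes "1 \<le> r" and "0 \<le> R"
  shows "convex ((\<lambda>u. y + L u) ` Lp_ball r M R)"
proof (rule convexI)
  fix y1 y2 and a b :: real
  assume ab: "0 \<le> a" "0 \<le> b" "a + b = 1"
  assume "y1 \<in> (\<lambda>u. y + L u) ` Lp_ball r M R" "y2 \<in> (\<lambda>u. y + L u) ` Lp_ball r M R"
  then obtain u v where u: "u \<in> Lp_ball r M R" "y1 = y + L u" and v: "v \<in> Lp_ball r M R" "y2 = y + L v"
    by blast
  note w = M.Lp_ball_convex[OF assms u(1) v(1) ab]
  note int = M.Lp_ball_integrable_norm[OF M.finite_measure_axioms assms]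
  have "a *\<^sub>R y1 + b *\<^sub>R y2 = (a + b) *\<^sub>R y + (a *\<^sub>R L u + b *\<^sub>R L v)"
    by (simp add: u(2) v(2) algebra_simps)
  also have "\<dots> = y + L (\<lambda>t. a *\<^sub>R u t + b *\<^sub>R v t)"
    using L_linear[OF Lp_ball_strongly_measurable[OF u(1)] int[OF u(1)] Lp_ball_strongly_measurable[OF v(1)]
        int[OF v(1)] int[OF w]]
    by (simp add: ab(3))
  finally show "a *\<^sub>R y1 + b *\<^sub>R y2 \<in> (\<lambda>u. y + L u) ` Lp_ball r M R"
    using w by blast
qed

text \<open>
  This is Hoelder's inequality for all pairs of conjugate exponents; the cases where one of them is infinite are
  direct estimates.
\<close>

lemma integral_le_dual_size:
  assumes exponents: "1 \<le> r" "1 \<le> q" "1 / r + 1 / q = 1" and "0 \<le> R"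
    and u: "u \<in> Lp_ball r M R"
    and g [measurable]: "g \<in> borel_measurable M" and g0: "\<And>t. 0 \<le> g t" and gK: "\<And>t. g t \<le> K'"
  shows "integrable M (\<lambda>t. g t * norm (u t))" and "(\<integral>t. g t * norm (u t) \<partial>M) \<le> dual_size q g * R"
proof -
  have int: "integrable M (\<lambda>t. norm (u t))"
    using M.Lp_ball_integrable_norm[OF M.finite_measure_axioms \<open>1 \<le> r\<close> \<open>0 \<le> R\<close> u] .
  then have [measurable]: "(\<lambda>t. norm (u t)) \<in> borel_measurable M" by auto
  show gu: "integrable M (\<lambda>t. g t * norm (u t))"
  proof (rule integrable_nonneg_dominated)
    show "integrable M (\<lambda>t. K' * norm (u t))" using int by simp
    show "(\<lambda>t. g t * norm (u t)) \<in> borel_measurable M" by measurable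
    show "0 \<le> g t * norm (u t)" for t using g0[of t] by simp
    show "g t * norm (u t) \<le> K' * norm (u t)" for t using gK[of t] by (rule mult_right_mono) simp
  qed
  have g_powr: "integrable M (\<lambda>t. g t powr s)" if "0 \<le> s" for s
    using g0 gK that by (intro M.integrable_const_bound[of _ "K' powr s"]) (auto intro!: powr_mono2)
  show "(\<integral>t. g t * norm (u t) \<partial>M) \<le> dual_size q g * R"
    using exponents
  proof (cases rule: conjugate_exponents_cases)
    case top_one
    have "AE t in M. norm (u t) \<le> R"
      using u \<open>0 \<le> R\<close> by (simp add: top_one M.Lp_ball_top_iff)
    then have le: "AE t in M. g t * norm (u t) \<le> g t * R"
      by eventually_elim (simp add: mult_left_mono g0)
    have "integrable M g"
      using g_powr[of 1] g0 by simp
    then have "(\<integral>t. g t * norm (u t) \<partial>M) \<le> (\<integral>t. g t * R \<partial>M)"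
      using gu le by (intro integral_mono_AE) auto
    also have "\<dots> = dual_size q g * R"
      using g0 \<open>integrable M g\<close> by (simp add: dual_size_def top_one)
    finally show ?thesis .
  next
    case one_top
    have "(\<integral>t. norm (u t) \<partial>M) \<le> R"
      using u \<open>0 \<le> R\<close> M.Lp_ball_finite_iff[of 1 R u] by (simp add: one_top)
    have bdd: "bdd_above (g ` {0..T})"
      using gK by (intro bdd_aboveI2)
    have G: "g t \<le> (SUP t\<in>{0..T}. g t)" if "t \<in> {0..T}" for t
      using that bdd by (rule cSUP_upper)
    have "(\<integral>t. g t * norm (u t) \<partial>M) \<le> (\<integral>t. (SUP t\<in>{0..T}. g t) * norm (u t) \<partial>M)"
      using G int gu by (intro integral_mono mult_right_mono) auto
    also have "\<dots> \<le> (SUP t\<in>{0..T}. g t) * R"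
      using \<open>(\<integral>t. norm (u t) \<partial>M) \<le> R\<close> order_trans[OF g0 G[of 0]] T_pos by (simp add: mult_left_mono)
    finally show ?thesis by (simp add: dual_size_def one_top)
  next
    case (finite p s)
    have up: "integrable M (\<lambda>t. norm (u t) powr p)" "(\<integral>t. norm (u t) powr p \<partial>M) \<le> R powr p"
      using u \<open>0 \<le> R\<close> finite by (simp_all add: M.Lp_ball_finite_iff)
    have "(\<integral>t. g t * norm (u t) \<partial>M) \<le>
        (\<integral>t. g t powr s \<partial>M) powr (1 / s) * (\<integral>t. norm (u t) powr p \<partial>M) powr (1 / p)"
      using finite g0 up g_powr[of s] by (intro Hoelder_inequality) simp_all
    also have "\<dots> \<le> (\<integral>t. g t powr s \<partial>M) powr (1 / s) * (R powr p) powr (1 / p)"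
      using up(2) finite by (intro mult_left_mono powr_mono2) auto
    also have "\<dots> = dual_size q g * R"
      using finite \<open>0 \<le> R\<close> by (simp add: dual_size_def powr_powr)
    finally show ?thesis .
  qed
qed

end

section \<open>Controls that nearly attain the dual norm\<close>

text \<open>
  In the application \<open>f\<close> is the real part of a functional \<open>x'\<close> and \<open>g t\<close> is the norm of \<open>x' \<circ> F t\<close>.
  Expressing \<open>g t\<close> as the supremum of \<open>f (F t v)\<close> over the unit ball lets the argument run over the reals for either
  scalar field.
\<close>

locale observed_control_operators = control_operators F T K
  for F :: "real \<Rightarrow> ('u::banach \<Rightarrow>\<^sub>L 'x::banach)" and T K :: real +
  fixes f :: "'x \<Rightarrow>\<^sub>L real" and g :: "real \<Rightarrow> real"
  assumes upper: "\<And>t v. norm v \<le> 1 \<Longrightarrow> blinfun_apply f (blinfun_apply (F t) v) \<le> g t"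
    and least: "\<And>t m. m < g t \<Longrightarrow> \<exists>v. norm v \<le> 1 \<and> m < blinfun_apply f (blinfun_apply (F t) v)"
begin

abbreviation \<phi> :: "'u \<Rightarrow> real \<Rightarrow> real"
  where "\<phi> v t \<equiv> blinfun_apply f (blinfun_apply (F t) v)"

lemma \<phi>_continuous: "continuous_on UNIV (\<phi> v)"
  by (intro continuous_intros strongly_continuous)

lemma g_nonneg: "0 \<le> g t"
  using upper[of 0 t] by simp

lemma \<phi>_le: "\<bar>\<phi> v t\<bar> \<le> norm f * K * norm v"
  using norm_blinfun[of f "blinfun_apply (F t) v"] mult_left_mono[OF apply_norm_le[of t v] norm_ge_zero[of f]]
  by (simp add: mult.assoc)

lemma g_le: "g t \<le> norm f * K"
proof (rule ccontr)
  assume "\<not> ?thesis"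
  then obtain v where v: "norm v \<le> 1" "norm f * K < \<phi> v t"
    using least[of "norm f * K" t] by auto
  have "\<phi> v t \<le> norm f * K * 1"
    using \<phi>_le[of t v] mult_left_mono[OF v(1), of "norm f * K"] K_nonneg by simp
  with v(2) show False by simp
qed

lemma dual_size_nonneg: "0 \<le> dual_size q g"
proof -
  have "bdd_above (g ` {0..T})"
    using g_le by (intro bdd_aboveI2)
  then have "0 \<le> (SUP t\<in>{0..T}. g t)"
    using T_pos order_trans[OF g_nonneg cSUP_upper[of 0 "{0..T}" g]] by simp
  then show ?thesis by (simp add: dual_size_def)
qed

text \<open>
  As a supremum of continuous functions, \<open>g\<close> is lower semicontinuous.
\<close>

lemma g_borel: "g \<in> borel_measurable borel"
proof (rule borel_measurableI_greater)
  fix m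
  have "{t. m < g t} = (\<Union>v\<in>cball 0 1. {t. m < \<phi> v t})"
    using upper least by (fastforce intro: less_le_trans)
  moreover have "open (\<Union>v\<in>cball 0 1. {t. m < \<phi> v t})"
    by (intro open_UN ballI open_Collect_less \<phi>_continuous continuous_intros)
  ultimately show "{t \<in> space borel. m < g t} \<in> sets borel" by simp
qed

lemma g_measurable [measurable]: "g \<in> borel_measurable M"
  using g_borel by (rule borel_measurable_lebesgue_on)

text \<open>
  For integrable controls the pairing is maximised by concentrating the control on a short interval: if \<open>f (F t v)\<close>
  exceeds \<open>m\<close> at some time, it does so on an interval \<open>A\<close> around it, and the constant control
  \<open>(R / |A|) v\<close> on \<open>A\<close> is admissible.
\<close>

lemma dual_size_attained_SUP:
  assumes "0 \<le> R" and "0 \<le> m" and "m < (SUP t\<in>{0..T}. g t)"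
  shows "\<exists>u\<in>Lp_ball 1 M R. R * m \<le> blinfun_apply f (L u)"
proof -
  have "bdd_above (g ` {0..T})"
    using g_le by (intro bdd_aboveI2)
  with assms(3) T_pos obtain t0 where t0: "t0 \<in> {0..T}" "m < g t0"
    using less_cSUP_iff[of "{0..T}" g m] by auto
  then obtain v where v: "norm v \<le> 1" "m < \<phi> v t0"
    using least by blast
  have "open {t. m < \<phi> v t}"
    by (intro open_Collect_less \<phi>_continuous continuous_intros)
  then obtain d where d: "d > 0" "\<And>t. dist t t0 < d \<Longrightarrow> m < \<phi> v t"
    using v(2) unfolding open_dist by blast
  \<comment> \<open>the supremum may sit at an endpoint, hence the interval is cut to lie between 0 and \<open>T\<close>\<close>
  define a where "a = max 0 (t0 - d)"
  define b where "b = min T (t0 + d)"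
  define A where "A = {a<..<b}"
  have ab: "a < b" "0 \<le> a" "b \<le> T"
    using t0(1) d(1) T_pos by (auto simp: a_def b_def)
  have A_sub: "A \<subseteq> {0<..<T}" using ab by (auto simp: A_def)
  have \<phi>_A: "m \<le> \<phi> v t" if "t \<in> A" for t
  proof -
    have "dist t t0 < d"
      using that by (auto simp: A_def a_def b_def dist_real_def)
    then show ?thesis by (rule less_imp_le[OF d(2)])
  qed
  have A_sets [measurable]: "A \<in> sets M"
    using A_sub by (auto simp: A_def sets_restrict_space_iff)
  have measure_A: "measure M A = b - a"
    using A_sub ab by (simp add: measure_restrict_space) (simp add: A_def)
  define c where "c = R / (b - a)"
  define u where "u t = (c * indicator A t) *\<^sub>R v" for t
  have "c \<ge> 0" using \<open>0 \<le> R\<close> ab by (simp add: c_def)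
  have u: "strongly_measurable M u"
    unfolding u_def by (intro strongly_measurable_scaleR strongly_measurable_borel strongly_measurable_const) measurable
  have norm_u: "norm (u t) = c * norm v * indicator A t" for t
    using \<open>c \<ge> 0\<close> by (simp add: u_def indicator_def)
  have int_A: "integrable M (indicator A :: real \<Rightarrow> real)" "(\<integral>t. indicator A t \<partial>M) = b - a"
  proof -
    have "emeasure M A < \<infinity>"
      using M.emeasure_finite[of A] unfolding infinity_ennreal_def by (rule top.not_eq_extremum[THEN iffD1])
    then show "integrable M (indicator A :: real \<Rightarrow> real)"
      by (rule integrable_real_indicator[OF A_sets])
    show "(\<integral>t. indicator A t \<partial>M) = b - a"
      using measure_A A_sub by (simp add: Int_absorb2)
  qed
  have int_u: "integrable M (\<lambda>t. norm (u t))" and "(\<integral>t. norm (u t) \<partial>M) = c * norm v * (b - a)"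
    using int_A by (simp_all add: norm_u)
  moreover have "c * norm v * (b - a) \<le> R"
    using v(1) ab \<open>0 \<le> R\<close> by (simp add: c_def mult_left_le)
  ultimately have ball: "u \<in> Lp_ball 1 M R"
    using u M.Lp_ball_finite_iff[of 1 R u] \<open>0 \<le> R\<close> by simp
  have "R * m = (\<integral>t. (c * m) * indicator A t \<partial>M)"
    using int_A ab by (simp add: c_def)
  also have "\<dots> \<le> (\<integral>t. \<phi> (u t) t \<partial>M)"
  proof (rule integral_mono)
    show "integrable M (\<lambda>t. c * m * indicator A t)" using int_A by simp
    show "integrable M (\<lambda>t. \<phi> (u t) t)" using functional_L(1)[OF u int_u] .
    show "c * m * indicator A t \<le> \<phi> (u t) t" for t
      using \<phi>_A[of t] \<open>c \<ge> 0\<close> by (simp add: u_def blinfun.scaleR_right indicator_def mult_left_mono)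
  qed
  also have "\<dots> = blinfun_apply f (L u)"
    using functional_L(2)[OF u int_u] by simp
  finally show ?thesis using ball by blast
qed

text \<open>
  The vector \<open>w n t\<close> is the best among \<open>0\<close> and the first \<open>n\<close> members of the sequence from
  \<open>countable_sup_subfamily\<close>.  Including \<open>0\<close> keeps the attained values nonnegative, so that they can be raised to real
  powers.
\<close>

lemma near_optimal_simple_functions:
  obtains w :: "nat \<Rightarrow> real \<Rightarrow> 'u" where "\<And>n. simple_function M (w n)" and "\<And>n t. norm (w n t) \<le> 1"
    and "\<And>n t. 0 \<le> \<phi> (w n t) t" and "\<And>t. (\<lambda>n. \<phi> (w n t) t) \<longlonglongrightarrow> g t"
proof -
  obtain v :: "nat \<Rightarrow> 'u" where v: "\<And>n. norm (v n) \<le> 1"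
    and v_sup: "\<And>w t m. norm w \<le> 1 \<Longrightarrow> m < \<phi> w t \<Longrightarrow> \<exists>n. m < \<phi> (v n) t"
    using countable_sup_subfamily[of "cball 0 1" \<phi>] \<phi>_continuous by (auto simp: image_subset_iff)
  define w where "w = rec_nat (\<lambda>_. 0) (\<lambda>n wn t. if \<phi> (wn t) t < \<phi> (v n) t then v n else wn t)"
  have w_0: "w 0 = (\<lambda>_. 0)"
    and w_Suc: "w (Suc n) = (\<lambda>t. if \<phi> (w n t) t < \<phi> (v n) t then v n else w n t)" for n
    unfolding w_def by simp_all
  have norm_w: "norm (w n t) \<le> 1" for n t
    by (induction n) (simp_all add: w_0 w_Suc v)
  have inc: "incseq (\<lambda>n. \<phi> (w n t) t)" for t
    by (rule incseq_SucI) (simp add: w_Suc)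
  have simple: "simple_function M (w n)" for n
  proof (induction n)
    case 0
    then show ?case by (simp add: w_0)
  next
    case (Suc n)
    have [measurable]: "(\<lambda>t. \<phi> (w n t) t) \<in> borel_measurable M"
      using strongly_measurable_apply[OF strongly_measurable_simple[OF Suc]]
      by (rule M.borel_measurable_continuous_strongly_measurable) (intro continuous_intros)
    have [measurable]: "\<phi> (v n) \<in> borel_measurable M"
      by (intro borel_measurable_lebesgue_on borel_measurable_continuous_onI \<phi>_continuous)
    show ?case
      unfolding w_Suc by (rule simple_function_If[OF simple_function_const Suc]) measurable
  qed
  have lim: "(\<lambda>n. \<phi> (w n t) t) \<longlonglongrightarrow> g t" for t
  proof (rule order_tendstoI)
    fix m assume "m < g t"
    then obtain x where "norm x \<le> 1" "m < \<phi> x t" using least by blast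
    then obtain k where "m < \<phi> (v k) t" using v_sup by blast
    then have "m < \<phi> (w (Suc k) t) t" by (simp add: w_Suc)
    then have "m < \<phi> (w n t) t" if "n \<ge> Suc k" for n
      using incseqD[OF inc[of t] that] by simp
    then show "\<forall>\<^sub>F n in sequentially. m < \<phi> (w n t) t"
      by (auto simp: eventually_sequentially)
  next
    fix m assume "g t < m"
    then show "\<forall>\<^sub>F n in sequentially. \<phi> (w n t) t < m"
      by (intro always_eventually allI le_less_trans[OF upper[OF norm_w]])
  qed
  have "0 \<le> \<phi> (w n t) t" for n t
    using incseqD[OF inc[of t], of 0 n] by (simp add: w_0)
  with simple norm_w lim show thesis using that by blast
qed

text \<open>
  The extremal function of Hoelder's inequality for \<open>h = f (F t (w t))\<close> is a multiple of \<open>h ^ (q - 1)\<close>, which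
  becomes a control after multiplication with the vectors \<open>w t\<close>.  By dominated convergence the integral of \<open>h ^ q\<close> is
  as close as needed to that of \<open>g ^ q\<close>.
\<close>

lemma dual_size_attained_integral:
  assumes exponents: "1 \<le> r" "1 \<le> ennreal q" "1 / r + 1 / ennreal q = 1" and "0 \<le> q" and "0 \<le> R" and "0 \<le> m"
    and m: "m < (\<integral>t. g t powr q \<partial>M) powr (1 / q)"
  shows "\<exists>u\<in>Lp_ball r M R. R * m \<le> blinfun_apply f (L u)"
proof -
  have "1 \<le> q" using exponents(2) \<open>0 \<le> q\<close> by simp
  obtain w :: "nat \<Rightarrow> real \<Rightarrow> 'u" where simple: "\<And>n. simple_function M (w n)"
    and norm_w: "\<And>n t. norm (w n t) \<le> 1"
    and w0: "\<And>n t. 0 \<le> \<phi> (w n t) t" and lim: "\<And>t. (\<lambda>n. \<phi> (w n t) t) \<longlonglongrightarrow> g t"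
    by (rule near_optimal_simple_functions) blast
  define h where "h n t = \<phi> (w n t) t" for n t
  have h0: "0 \<le> h n t" for n t by (simp add: h_def w0)
  have h_le: "h n t \<le> norm f * K" for n t
    using order_trans[OF upper[OF norm_w] g_le] by (simp add: h_def)
  have [measurable]: "h n \<in> borel_measurable M" for n
    using strongly_measurable_apply[OF strongly_measurable_simple[OF simple[of n]]]
    unfolding h_def by (rule M.borel_measurable_continuous_strongly_measurable) (intro continuous_intros)
  have h_int: "integrable M (\<lambda>t. h n t powr s)" if "0 \<le> s" for n s
    using h0 h_le that by (intro M.integrable_const_bound[of _ "(norm f * K) powr s"]) (auto intro!: powr_mono2)
  have "(\<lambda>n. \<integral>t. h n t powr q \<partial>M) \<longlonglongrightarrow> (\<integral>t. g t powr q \<partial>M)"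
  proof (rule integral_dominated_convergence[where w = "\<lambda>_. (norm f * K) powr q"])
    show "AE t in M. (\<lambda>n. h n t powr q) \<longlonglongrightarrow> g t powr q"
      using lim \<open>1 \<le> q\<close> h0 by (intro AE_I2 tendsto_powr') (auto simp: h_def w0)
    show "AE t in M. norm (h n t powr q) \<le> (norm f * K) powr q" for n
      using h0 h_le \<open>1 \<le> q\<close> by (auto intro!: powr_mono2)
  qed auto
  then have "(\<lambda>n. (\<integral>t. h n t powr q \<partial>M) powr (1 / q)) \<longlonglongrightarrow> (\<integral>t. g t powr q \<partial>M) powr (1 / q)"
    using \<open>1 \<le> q\<close> by (intro tendsto_powr') auto
  from order_tendstoD(1)[OF this m]
  obtain n where n: "m < (\<integral>t. h n t powr q \<partial>M) powr (1 / q)"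
    by (auto simp: eventually_sequentially)
  define J where "J = (\<integral>t. h n t powr q \<partial>M)"
  have "J \<noteq> 0" using n \<open>0 \<le> m\<close> by (auto simp: J_def)
  then have "J > 0" by (simp add: J_def less_le)
  \<comment> \<open>normalises the control to norm \<open>R\<close>, since \<open>(q - 1) p = q\<close> and \<open>(1 / q - 1) p = - 1\<close>\<close>
  define c where "c = R * J powr (1 / q - 1)"
  have "c \<ge> 0" using \<open>0 \<le> R\<close> by (simp add: c_def)
  define u where "u t = (c * h n t powr (q - 1)) *\<^sub>R w n t" for t
  have u: "strongly_measurable M u"
    unfolding u_def
    by (intro strongly_measurable_scaleR strongly_measurable_borel strongly_measurable_simple simple) measurable
  have norm_u: "norm (u t) \<le> c * h n t powr (q - 1)" for t
    using norm_w[of n t] \<open>c \<ge> 0\<close> by (simp add: u_def mult_left_le)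
  have ball: "u \<in> Lp_ball r M R"
    using exponents
  proof (cases rule: conjugate_exponents_cases)
    case top_one
    then have "q = 1" using \<open>0 \<le> q\<close> by simp
    then have "c = R" using \<open>J > 0\<close> by (simp add: c_def)
    have "norm (u t) \<le> R" for t
      using norm_u[of t] \<open>q = 1\<close> \<open>c = R\<close> \<open>0 \<le> R\<close> by (simp split: if_splits)
    then show ?thesis
      using u \<open>0 \<le> R\<close> by (simp add: top_one M.Lp_ball_top_iff)
  next
    case (finite p s)
    then have "s = q" using \<open>0 \<le> q\<close> by (auto simp: ennreal_inj)
    have pq: "(q - 1) * p = q" "(1 / q - 1) * p = - 1"
      using finite \<open>s = q\<close> by (auto simp: field_simps)
    have "norm (u t) powr p \<le> R powr p * inverse J * h n t powr q" for t
    proof -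
      have "norm (u t) powr p \<le> (c * h n t powr (q - 1)) powr p"
        using norm_u finite by (intro powr_mono2) auto
      also have "\<dots> = R powr p * J powr ((1 / q - 1) * p) * h n t powr ((q - 1) * p)"
        by (simp only: c_def powr_mult powr_powr)
      finally show ?thesis
        using \<open>J > 0\<close> by (simp only: pq) (simp add: powr_minus)
    qed
    moreover have dom: "integrable M (\<lambda>t. R powr p * inverse J * h n t powr q)"
      using h_int[of q n] \<open>0 \<le> q\<close> by simp
    moreover have meas: "(\<lambda>t. norm (u t) powr p) \<in> borel_measurable M"
      using M.borel_measurable_norm_strongly_measurable[OF u] by measurable
    ultimately have int: "integrable M (\<lambda>t. norm (u t) powr p)"
      by (intro integrable_nonneg_dominated[OF dom meas]) auto
    have "(\<integral>t. norm (u t) powr p \<partial>M) \<le> (\<integral>t. R powr p * inverse J * h n t powr q \<partial>M)"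
      using int dom \<open>\<And>t. norm (u t) powr p \<le> R powr p * inverse J * h n t powr q\<close> by (rule integral_mono)
    also have "\<dots> = R powr p"
      using \<open>J > 0\<close> by (simp add: J_def)
    finally show ?thesis
      using u int finite \<open>0 \<le> R\<close> by (simp add: M.Lp_ball_finite_iff)
  qed simp
  have int_u: "integrable M (\<lambda>t. norm (u t))"
    using M.Lp_ball_integrable_norm[OF M.finite_measure_axioms \<open>1 \<le> r\<close> \<open>0 \<le> R\<close> ball] .
  have "R * m \<le> R * J powr (1 / q)"
    using n \<open>0 \<le> R\<close> by (intro mult_left_mono) (simp_all add: J_def)
  also have "\<dots> = c * J"
    using \<open>J > 0\<close> by (simp add: c_def powr_diff)
  also have "\<dots> = (\<integral>t. c * h n t powr q \<partial>M)"
    by (simp add: J_def)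
  also have "\<dots> = (\<integral>t. \<phi> (u t) t \<partial>M)"
  proof (rule Bochner_Integration.integral_cong[OF refl])
    fix t
    have "h n t * h n t powr (q - 1) = h n t powr q"
      using powr_mult_base[OF h0[of n t], of "q - 1"] by simp
    then show "c * h n t powr q = \<phi> (u t) t"
      by (simp add: u_def blinfun.scaleR_right h_def[symmetric] mult.commute mult.left_commute)
  qed
  also have "\<dots> = blinfun_apply f (L u)"
    using functional_L(2)[OF u int_u] by simp
  finally show ?thesis using ball by blast
qed

theorem dual_size_nearly_attained:
  assumes exponents: "1 \<le> r" "1 \<le> q" "1 / r + 1 / q = 1" and "0 \<le> R" and m: "0 \<le> m" "m < dual_size q g"
  shows "\<exists>u\<in>Lp_ball r M R. R * m \<le> blinfun_apply f (L u)"
proof (cases "q = \<infinity>")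
  case True
  from exponents have "r = 1"
    by (cases rule: conjugate_exponents_cases) (use True in auto)
  with dual_size_attained_SUP[OF \<open>0 \<le> R\<close> m(1)] m(2) True show ?thesis
    by (simp add: dual_size_def)
next
  case False
  then obtain s where s: "q = ennreal s" "0 \<le> s"
    by (cases q) auto
  show ?thesis
    using exponents m(2) \<open>0 \<le> R\<close> m(1) False s(2) unfolding s(1)
    by (intro dual_size_attained_integral) (simp_all add: dual_size_def)
qed

text \<open>
  Allowing the error \<open>e\<close> covers the degenerate cases as well, where the dual norm is small and the zero control
  serves.
\<close>

corollary near_optimal_control:
  assumes exponents: "1 \<le> r" "1 \<le> q" "1 / r + 1 / q = 1" and "0 \<le> R" and "0 < e"
  shows "\<exists>u\<in>Lp_ball r M R. R * dual_size q g - e \<le> blinfun_apply f (L u)"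
proof -
  \<comment> \<open>the summand 1 admits \<open>R = 0\<close>\<close>
  define m where "m = dual_size q g - e / (R + 1)"
  have m: "R * dual_size q g - e \<le> R * m" "m < dual_size q g"
    using \<open>0 \<le> R\<close> \<open>0 < e\<close> by (simp_all add: m_def field_simps)
  show ?thesis
  proof (cases "0 \<le> m")
    case True
    then show ?thesis
      using dual_size_nearly_attained[OF exponents \<open>0 \<le> R\<close> _ m(2)] m(1) by (meson order_trans)
  next
    case False
    have "(\<lambda>_. 0) \<in> Lp_ball r M R"
      using \<open>1 \<le> r\<close>
      by (cases rule: one_le_ennreal_cases)
        (simp_all add: M.Lp_ball_finite_iff M.Lp_ball_top_iff strongly_measurable_const \<open>0 \<le> R\<close>)
    moreover have "blinfun_apply f (L (\<lambda>_. 0)) = 0"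
      using functional_L(2)[OF strongly_measurable_const, of 0 f] by simp
    moreover have "R * m \<le> 0"
      using False \<open>0 \<le> R\<close> by (simp add: mult_nonneg_nonpos)
    ultimately show ?thesis
      using m(1) by (intro bexI[of _ "\<lambda>_. 0"]) simp_all
  qed
qed

theorem functional_control_bound:
  assumes exponents: "1 \<le> r" "1 \<le> q" "1 / r + 1 / q = 1" and "0 \<le> R" and u: "u \<in> Lp_ball r M R"
  shows "- blinfun_apply f (L u) \<le> dual_size q g * R"
proof -
  have meas: "strongly_measurable M u" and int: "integrable M (\<lambda>t. norm (u t))"
    using u M.Lp_ball_integrable_norm[OF M.finite_measure_axioms \<open>1 \<le> r\<close> \<open>0 \<le> R\<close> u]
    by (simp_all add: Lp_ball_strongly_measurable)
  note bound = integral_le_dual_size[OF exponents \<open>0 \<le> R\<close> u g_measurable g_nonneg g_le]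
  have pointwise: "- \<phi> v t \<le> g t * norm v" for v t
  proof (cases "v = 0")
    case False
    then have "norm v * \<phi> (- inverse (norm v) *\<^sub>R v) t \<le> norm v * g t"
      by (intro mult_left_mono upper) simp_all
    with False show ?thesis
      by (simp add: blinfun.scaleR_right blinfun.minus_right field_simps)
  qed simp
  have "- blinfun_apply f (L u) = (\<integral>t. - \<phi> (u t) t \<partial>M)"
    using functional_L(2)[OF meas int] by simp
  also have "\<dots> \<le> (\<integral>t. g t * norm (u t) \<partial>M)"
    using functional_L(1)[OF meas int, of f] bound(1) pointwise by (intro integral_mono) auto
  also note bound(2)
  finally show ?thesis .
qed

end

section \<open>Controllability and observability of the semigroup\<close>

text \<open>
  The controllability map runs the semigroup backwards in time, whereas the observability estimate runs it
  forwards.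
\<close>

lemma set_integral_reflect:
  fixes h :: "real \<Rightarrow> real"
  assumes [measurable]: "h \<in> borel_measurable borel"
  shows "(LINT t:{0..T}|lebesgue. h (T - t)) = (\<integral>t. h t \<partial>lebesgue_on {0<..<T})"
proof -
  have "(LINT t:{0..T}|lebesgue. h (T - t)) = (\<integral>t. indicator {0..T} t * h (T - t) \<partial>lborel)"
    unfolding set_lebesgue_integral_def by (subst integral_completion) simp_all
  also have "\<dots> = (\<integral>t. indicator {0..T} (T - t) * h t \<partial>lborel)"
    by (subst lborel_integral_real_affine[where c = "-1" and t = T]) simp_all
  also have "\<dots> = (\<integral>t. indicator {0<..<T} t * h t \<partial>lborel)"
  proof (rule integral_cong_AE)
    show "AE t in lborel. indicator {0..T} (T - t) * h t = indicator {0<..<T} t * h t"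
      using AE_lborel_singleton[of 0] AE_lborel_singleton[of T]
      by eventually_elim (auto simp: indicator_def)
  qed measurable
  also have "\<dots> = (\<integral>t. indicator {0<..<T} t * h t \<partial>lebesgue)"
    by (subst integral_completion) simp_all
  also have "\<dots> = (\<integral>t. h t \<partial>lebesgue_on {0<..<T})"
    by (simp add: integral_restrict_space)
  finally show ?thesis .
qed

lemma real_part_functional:
  fixes x' :: "'x::real_normed_vector \<Rightarrow>\<^sub>L 'k::real_or_complex"
  obtains f :: "'x \<Rightarrow>\<^sub>L real" where "\<And>y. blinfun_apply f y = scalar_re (blinfun_apply x' y)"
proof -
  have "bounded_linear (\<lambda>y. scalar_re (blinfun_apply x' y))"
    by (rule bounded_linear_compose[OF bounded_linear_scalar_re blinfun.bounded_linear_right])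
  from bounded_linear_Blinfun_apply[OF this] that show thesis by metis
qed

theorem theorem2p8:
  fixes scaleX :: "'k::real_or_complex \<Rightarrow> 'x::banach \<Rightarrow> 'x"
    and scaleU :: "'k \<Rightarrow> 'u::banach \<Rightarrow> 'u"
    and S :: "real \<Rightarrow> ('x \<Rightarrow>\<^sub>L 'x)"
    and B :: "'u \<Rightarrow>\<^sub>L 'x"
    and T C \<alpha> :: real
    and r r' :: ennreal
  assumes "normed_space_over scaleX"
    and "normed_space_over scaleU"
    and "C0_semigroup scaleX S"
    and "B \<in> bounded_ops scaleU scaleX"
    and "T > 0"
    and "1 \<le> r"
    and "1 \<le> r'"
    and "1 / r + 1 / r' = 1"
    and "C \<ge> 0"
    and "\<alpha> \<ge> 0"
  shows
    "(\<forall>x. x \<noteq> 0 \<longrightarrow> (\<forall>\<epsilon>>0. \<exists>u \<in> Lp_space r (lebesgue_on {0<..<T}).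
        Lp_norm r (lebesgue_on {0<..<T}) u \<le> C * norm x \<and>
        norm (blinfun_apply (S T) x + controllability_map S B T u) < (\<alpha> + \<epsilon>) * norm x))
     \<longleftrightarrow>
     (\<forall>x' \<in> dual_space scaleX.
        norm (dual_op (S T) x') \<le>
          (if r' = \<infinity>
           then C * (SUP t\<in>{0..T}. norm (dual_op B (dual_op (S t) x'))) + \<alpha> * norm x'
           else C * (LINT t:{0..T}|lebesgue. norm (dual_op B (dual_op (S t) x')) powr enn2real r')
                      powr (1 / enn2real r')
                + \<alpha> * norm x'))"
proof -
  interpret X: normed_space_over scaleX by fact
  interpret U: normed_space_over scaleU by fact
  note exponents = \<open>1 \<le> r\<close> \<open>1 \<le> r'\<close> \<open>1 / r + 1 / r' = 1\<close>
  have S_ops: "S t \<in> bounded_ops scaleX scaleX" if "0 \<le> t" for t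
    using \<open>C0_semigroup scaleX S\<close> that by (simp add: C0_semigroup_def)
  obtain Mb where Mb: "Mb \<ge> 0" "\<And>t. 0 \<le> t \<Longrightarrow> t \<le> T \<Longrightarrow> norm (S t) \<le> Mb"
    using C0_semigroup_bounded[OF \<open>C0_semigroup scaleX S\<close>] by metis
  \<comment> \<open>keeps the argument of the semigroup in its domain, so that \<open>F\<close> is continuous on the whole real line\<close>
  define clamp where "clamp t = max 0 (min T (T - t))" for t :: real
  have clamp: "clamp t \<in> {0..T}" "t \<in> {0..T} \<Longrightarrow> clamp t = T - t" for t
    using \<open>T > 0\<close> by (auto simp: clamp_def)
  define F where "F t = S (clamp t) o\<^sub>L B" for t
  interpret control_operators F T "Mb * norm B"
  proof
    show "0 < T" by fact
    show "continuous_on UNIV (\<lambda>t. blinfun_apply (F t) v)" for v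
    proof -
      have "continuous_on UNIV ((\<lambda>t. blinfun_apply (S t) (blinfun_apply B v)) \<circ> clamp)"
        using clamp(1)
        by (intro continuous_on_compose continuous_on_subset[OF C0_semigroup_strongly_continuous[OF \<open>C0_semigroup scaleX S\<close>, of T]])
          (auto simp: clamp_def intro!: continuous_intros)
      then show ?thesis by (simp add: F_def o_def)
    qed
    show "norm (F t) \<le> Mb * norm B" for t
      unfolding F_def using Mb clamp(1)[of t]
      by (intro order_trans[OF norm_blinfun_compose] mult_right_mono) auto
  qed
  have L_eq: "controllability_map S B T u = L u" for u
    unfolding controllability_map_def L_def
    by (rule strong_bochner_integral_cong) (simp add: F_def clamp(2))
  define g where "g x' t = norm (dual_op (F t) x' :: 'u \<Rightarrow>\<^sub>L 'k)" for x' :: "'x \<Rightarrow>\<^sub>L 'k" and t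
  have observed: "observed_control_operators F T (Mb * norm B) f (g x')"
    if x': "x' \<in> dual_space scaleX" and f: "\<And>y. blinfun_apply f y = scalar_re (blinfun_apply x' y)" for f x'
  proof unfold_locales
    have dual: "dual_op (F t) x' \<in> dual_space scaleU" for t
      unfolding F_def dual_op_dual_op[symmetric] using \<open>B \<in> _\<close> S_ops clamp(1)[of t] x'
      by (intro dual_op_in_dual_space[of _ _ scaleX]) auto
    show "blinfun_apply f (blinfun_apply (F t) v) \<le> g x' t" if "norm v \<le> 1" for t v
    proof -
      have "blinfun_apply f (blinfun_apply (F t) v) \<le> norm (blinfun_apply (dual_op (F t) x') v)"
        using scalar_re_le_norm[of "blinfun_apply x' (blinfun_apply (F t) v)"] by (simp add: f dual_op_def)
      also have "\<dots> \<le> g x' t * norm v"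
        unfolding g_def by (rule norm_blinfun)
      also have "\<dots> \<le> g x' t"
        using that by (simp add: g_def mult_left_le)
      finally show ?thesis .
    qed
    show "\<exists>v. norm v \<le> 1 \<and> m < blinfun_apply f (blinfun_apply (F t) v)" if "m < g x' t" for t m
      using U.dual_near_norm[OF dual that[unfolded g_def]] by (metis f dual_op_def blinfun_apply_blinfun_compose)
  qed
  have rhs: "(if r' = \<infinity>
           then C * (SUP t\<in>{0..T}. norm (dual_op B (dual_op (S t) x'))) + \<alpha> * norm x'
           else C * (LINT t:{0..T}|lebesgue. norm (dual_op B (dual_op (S t) x')) powr enn2real r')
                      powr (1 / enn2real r')
                + \<alpha> * norm x') = C * dual_size r' (g x') + \<alpha> * norm x'"
    if x': "x' \<in> dual_space scaleX" for x'
  proof -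
    obtain f :: "'x \<Rightarrow>\<^sub>L real" where f: "\<And>y. blinfun_apply f y = scalar_re (blinfun_apply x' y)"
      using real_part_functional[of x'] by blast
    interpret observed_control_operators F T "Mb * norm B" f "g x'"
      using x' f by (rule observed)
    have eq: "norm (dual_op B (dual_op (S t) x')) = g x' (T - t)" if "t \<in> {0..T}" for t
      using that clamp(2)[of "T - t"] by (simp add: g_def F_def dual_op_dual_op)
    have "(SUP t\<in>{0..T}. norm (dual_op B (dual_op (S t) x'))) = (SUP t\<in>{0..T}. g x' t)"
    proof -
      have "(\<lambda>t. norm (dual_op B (dual_op (S t) x'))) ` {0..T} = g x' ` (\<lambda>t. T - t) ` {0..T}"
        unfolding image_image using eq by (rule image_cong[OF refl])
      then show ?thesis by simp
    qed
    moreover have "(LINT t:{0..T}|lebesgue. norm (dual_op B (dual_op (S t) x')) powr enn2real r')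
        = (\<integral>t. g x' t powr enn2real r' \<partial>M)"
    proof -
      have "(LINT t:{0..T}|lebesgue. norm (dual_op B (dual_op (S t) x')) powr enn2real r')
          = (LINT t:{0..T}|lebesgue. g x' (T - t) powr enn2real r')"
        unfolding set_lebesgue_integral_def
        by (intro Bochner_Integration.integral_cong refl) (simp add: indicator_def eq)
      also have "\<dots> = (\<integral>t. g x' t powr enn2real r' \<partial>M)"
        using g_borel by (intro set_integral_reflect powr_real_measurable borel_measurable_const)
      finally show ?thesis .
    qed
    ultimately show ?thesis by (simp add: dual_size_def)
  qed
  have forward: "norm (dual_op (S T) x') \<le> C * dual_size r' (g x') + \<alpha> * norm x'"
    if reach: "\<And>x \<epsilon>. x \<noteq> 0 \<Longrightarrow> \<epsilon> > 0 \<Longrightarrow> \<exists>u\<in>Lp_ball r M (C * norm x).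
        norm (blinfun_apply (S T) x + L u) < (\<alpha> + \<epsilon>) * norm x"
      and x': "x' \<in> dual_space scaleX" for x'
  proof -
    obtain f :: "'x \<Rightarrow>\<^sub>L real" where f: "\<And>y. blinfun_apply f y = scalar_re (blinfun_apply x' y)"
      using real_part_functional[of x'] by blast
    interpret observed_control_operators F T "Mb * norm B" f "g x'"
      using x' f by (rule observed)
    have f_le: "blinfun_apply f y \<le> norm x' * norm y" for y
      using scalar_re_le_norm[of "blinfun_apply x' y"] norm_blinfun[of x' y] by (simp add: f)
    have bound: "blinfun_apply f (blinfun_apply (S T) x) \<le> (C * dual_size r' (g x') + \<alpha> * norm x') * norm x" for x
    proof (cases "x = 0")
      case False
      show ?thesis
      proof (rule field_le_epsilon)
        fix e :: real assume "e > 0"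
        \<comment> \<open>the denominator stays positive when \<open>x'\<close> vanishes\<close>
        define \<epsilon> where "\<epsilon> = e / ((norm x' + 1) * norm x)"
        have "norm x > 0" using False by simp
        have "norm x' + 1 > 0" by (simp add: add_nonneg_pos)
        have "\<epsilon> > 0"
          using \<open>e > 0\<close> \<open>norm x > 0\<close> \<open>norm x' + 1 > 0\<close> by (simp add: \<epsilon>_def)
        have "norm x' * \<epsilon> * norm x = e * (norm x' / (norm x' + 1))"
          using \<open>norm x > 0\<close> by (simp add: \<epsilon>_def)
        also have "\<dots> \<le> e * 1"
          using \<open>e > 0\<close> \<open>norm x' + 1 > 0\<close> by (intro mult_left_mono) (simp_all add: divide_le_eq)
        finally have small: "norm x' * \<epsilon> * norm x \<le> e" by simp
        obtain u where u: "u \<in> Lp_ball r M (C * norm x)"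
          and close: "norm (blinfun_apply (S T) x + L u) < (\<alpha> + \<epsilon>) * norm x"
          using reach[OF False \<open>\<epsilon> > 0\<close>] by blast
        have "blinfun_apply f (blinfun_apply (S T) x)
            = blinfun_apply f (blinfun_apply (S T) x + L u) + - blinfun_apply f (L u)"
          by (simp add: blinfun.add_right)
        also have "\<dots> \<le> norm x' * ((\<alpha> + \<epsilon>) * norm x) + dual_size r' (g x') * (C * norm x)"
        proof (rule add_mono)
          show "blinfun_apply f (blinfun_apply (S T) x + L u) \<le> norm x' * ((\<alpha> + \<epsilon>) * norm x)"
            using f_le mult_left_mono[OF less_imp_le[OF close] norm_ge_zero[of x']] by (rule order_trans)
          show "- blinfun_apply f (L u) \<le> dual_size r' (g x') * (C * norm x)"
            using exponents \<open>C \<ge> 0\<close> u by (intro functional_control_bound) auto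
        qed
        also have "\<dots> = (C * dual_size r' (g x') + \<alpha> * norm x') * norm x + norm x' * \<epsilon> * norm x"
          by (simp add: algebra_simps)
        also have "\<dots> \<le> (C * dual_size r' (g x') + \<alpha> * norm x') * norm x + e"
          using small by simp
        finally show "blinfun_apply f (blinfun_apply (S T) x)
            \<le> (C * dual_size r' (g x') + \<alpha> * norm x') * norm x + e" .
      qed
    qed simp
    show ?thesis
    proof (rule X.dual_norm_le)
      show "dual_op (S T) x' \<in> dual_space scaleX"
        using S_ops[of T] \<open>T > 0\<close> x' by (intro dual_op_in_dual_space[of _ _ scaleX]) auto
      show "0 \<le> C * dual_size r' (g x') + \<alpha> * norm x'"
        using \<open>C \<ge> 0\<close> \<open>\<alpha> \<ge> 0\<close> dual_size_nonneg by simp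
      show "scalar_re (blinfun_apply (dual_op (S T) x') x) \<le> (C * dual_size r' (g x') + \<alpha> * norm x') * norm x" for x
        using bound[of x] by (simp add: f dual_op_def)
    qed
  qed
  have backward: "\<exists>u\<in>Lp_ball r M (C * norm x). norm (blinfun_apply (S T) x + L u) < (\<alpha> + \<epsilon>) * norm x"
    if dual: "\<And>x'. x' \<in> dual_space scaleX \<Longrightarrow>
        norm (dual_op (S T) x') \<le> C * dual_size r' (g x') + \<alpha> * norm x'"
      and "x \<noteq> 0" and "\<epsilon> > 0" for x \<epsilon>
  proof (rule ccontr)
    assume "\<not> ?thesis"
    then have far: "(\<alpha> + \<epsilon>) * norm x \<le> norm y" if "y \<in> (\<lambda>u. blinfun_apply (S T) x + L u) ` Lp_ball r M (C * norm x)" for y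
      using that by (auto simp: not_less)
    have conv: "convex ((\<lambda>u. blinfun_apply (S T) x + L u) ` Lp_ball r M (C * norm x))"
      using exponents \<open>C \<ge> 0\<close> by (intro convex_reachable) auto
    obtain h :: "'x \<Rightarrow>\<^sub>L real" where "norm h \<le> 1"
      and sep: "\<And>u. u \<in> Lp_ball r M (C * norm x) \<Longrightarrow> (\<alpha> + \<epsilon>) * norm x \<le> blinfun_apply h (blinfun_apply (S T) x + L u)"
      using separate_convex_from_ball[OF conv far] by (metis image_eqI)
    \<comment> \<open>the sign is changed because the control has to push against the separating functional\<close>
    obtain x' where x': "x' \<in> dual_space scaleX" and re: "\<And>y. scalar_re (blinfun_apply x' y) = blinfun_apply (- h) y"
      and "norm x' \<le> norm (- h)"
      using X.functional_with_real_part[of "- h"] by blast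
    then have "norm x' \<le> 1" using \<open>norm h \<le> 1\<close> by simp
    interpret observed_control_operators F T "Mb * norm B" "- h" "g x'"
      using x' re[symmetric] by (rule observed)
    have "\<epsilon> / 2 * norm x > 0" using \<open>x \<noteq> 0\<close> \<open>\<epsilon> > 0\<close> by simp
    with near_optimal_control[OF exponents, of "C * norm x"] \<open>C \<ge> 0\<close>
    obtain u where u: "u \<in> Lp_ball r M (C * norm x)"
      and large: "C * norm x * dual_size r' (g x') - \<epsilon> / 2 * norm x \<le> blinfun_apply (- h) (L u)"
      by (meson mult_nonneg_nonneg norm_ge_zero)
    have "blinfun_apply h (blinfun_apply (S T) x) \<le> norm (blinfun_apply (dual_op (S T) x') x)"
      using scalar_re_le_norm[of "blinfun_apply x' (blinfun_apply (S T) x)"] re[of "blinfun_apply (S T) x"]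
      by (simp add: dual_op_def blinfun.minus_left)
    also have "\<dots> \<le> norm (dual_op (S T) x') * norm x"
      by (rule norm_blinfun)
    also have "\<dots> \<le> (C * dual_size r' (g x') + \<alpha> * norm x') * norm x"
      using dual[OF x'] by (intro mult_right_mono) auto
    also have "\<dots> \<le> (C * dual_size r' (g x') + \<alpha> * 1) * norm x"
      using \<open>norm x' \<le> 1\<close> \<open>\<alpha> \<ge> 0\<close> by (intro mult_right_mono add_left_mono mult_left_mono) auto
    finally have "\<epsilon> * norm x \<le> \<epsilon> / 2 * norm x"
      using sep[OF u] large by (simp add: blinfun.add_right blinfun.minus_left algebra_simps)
    with \<open>\<epsilon> / 2 * norm x > 0\<close> show False by simp
  qed
  have lhs: "(\<exists>u \<in> Lp_space r M. Lp_norm r M u \<le> C * norm x \<and>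
        norm (blinfun_apply (S T) x + controllability_map S B T u) < (\<alpha> + \<epsilon>) * norm x)
      \<longleftrightarrow> (\<exists>u\<in>Lp_ball r M (C * norm x). norm (blinfun_apply (S T) x + L u) < (\<alpha> + \<epsilon>) * norm x)" for x \<epsilon>
    by (auto simp: Lp_ball_def L_eq)
  show ?thesis
    unfolding lhs
  proof (intro iffI ballI allI impI, goal_cases)
    case (1 x')
    show ?case
      unfolding rhs[OF 1(2)] by (rule forward[OF _ 1(2)]) (use 1(1) in blast)
  next
    case (2 x \<epsilon>)
    show ?case
    proof (rule backward[OF _ 2(2,3)])
      show "norm (dual_op (S T) x') \<le> C * dual_size r' (g x') + \<alpha> * norm x'" if "x' \<in> dual_space scaleX" for x'
        using bspec[OF 2(1) that] unfolding rhs[OF that] .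
    qed
  qed
qed

end
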